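(* Let $A$ be a finite associative conformal algebra which is free as a $\mathbb{C}[\partial]$-module. Suppose that there is an associative conformal algebra structure on $A^{\ast c}$. Then there is a double construction of Frobenius conformal algebra associated to $A$ and $A^{\ast c}$ if and only if $(A,A^{\ast c},R_A^\ast,L_A^\ast,R_{A^{\ast c}}^\ast,L_{A^{\ast c}}^\ast)$ is a matched pair of associative conformal algebras.
   Context: Everything is over $\mathbb{C}$. An associative conformal algebra is a $\mathbb{C}[\partial]$-module $A$ with a $\mathbb{C}$-bilinear map $A\times A\to A[\lambda]$, $(a,b)\mapsto a_\lambda b$, such that $(\partial a)_\lambda b=-\lambda a_\lambda b$, $a_\lambda(\partial b)=(\partial+\lambda)(a_\lambda b)$ and $(a_\lambda b)_{\lambda+\mu}c=a_\lambda(b_\mu c)$. It is finite if finitely generated as a $\mathbb{C}[\partial]$-module. Subalgebras are $\mathbb{C}[\partial]$-submodules closed under the $\lambda$-product. Convention: an expression with $\partial$ in a subscript, such as $x_{-\lambda-\partial}y$, means: write $x_\nu y=\sum_k\nu^k c_k$ and take $\sum_k(-\lambda-\partial)^kc_k$, with $\partial$ acting on the $c_k$ (similarly for $\phi_{-\lambda-\partial}v$). $Chom(U,V)$: $\mathbb{C}$-linear maps $a_\lambda:U\to V[\lambda]$ with $a_\lambda(\partial u)=(\partial+\lambda)a_\lambda u$, a $\mathbb{C}[\partial]$-module via $(\partial a)_\lambda=-\lambda a_\lambda$; $Cend(V)=Chom(V,V)$; the conformal dual is $U^{\ast c}=Chom(U,\mathbb{C})$, $\mathbb{C}$ with $\partial=0$.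 Bimodule $(M,l_A,r_A)$ of $A$: a $\mathbb{C}[\partial]$-module $M$ with $\mathbb{C}[\partial]$-module homomorphisms $l_A,r_A:A\to Cend(M)$ such that $l_A(a_\lambda b)_{\lambda+\mu}v=l_A(a)_\lambda(l_A(b)_\mu v)$, $r_A(b)_{-\lambda-\mu-\partial}(r_A(a)_{-\lambda-\partial}v)=r_A(a_\mu b)_{-\lambda-\partial}v$, $l_A(a)_\lambda(r_A(b)_{-\mu-\partial}v)=r_A(b)_{-\lambda-\mu-\partial}(l_A(a)_\lambda v)$. $L_A(a)_\lambda b=a_\lambda b$, $R_A(a)_\lambda b=b_{-\lambda-\partial}a$. Their duals $L_A^\ast,R_A^\ast:A\to Cend(A^{\ast c})$ are $(L_A^\ast(a)_\lambda f)_\mu b=f_{\mu-\lambda}(L_A(a)_\lambda b)$, $(R_A^\ast(a)_\lambda f)_\mu b=f_{\mu-\lambda}(R_A(a)_\lambda b)$. Likewise $L_{A^{\ast c}}^\ast,R_{A^{\ast c}}^\ast:A^{\ast c}\to Cend(A)$ are defined from the algebra $A^{\ast c}$ after identifying $A\cong (A^{\ast c})^{\ast c}$ by $a_\mu(h)=h_{-\mu}(a)$; explicitly $h_{-\mu}(L_{A^{\ast c}}^\ast(f)_\lambda a)=(f_\lambda h)_{\lambda-\mu}(a)$ and $h_{-\mu}(R_{A^{\ast c}}^\ast(f)_\lambda a)=(R_{A^{\ast c}}(f)_\lambda h)_{\lambda-\mu}(a)$ with $R_{A^{\ast c}}(f)_\lambda h=h_{-\lambda-\partial}f$. Matched pair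 $(A,B,l_A,r_A,l_B,r_B)$: $A,B$ are associative conformal algebras, $(B,l_A,r_A)$ is a bimodule of $A$, $(A,l_B,r_B)$ is a bimodule of $B$, and for all $a,b\in A$, $x,y\in B$: (1) $l_A(a)_\lambda(x_\mu y)=(l_A(a)_\lambda x)_{\lambda+\mu}y+l_A(r_B(x)_{-\lambda-\partial}a)_{\lambda+\mu}y$; (2) $r_B(x)_{-\lambda-\mu-\partial}(a_\lambda b)=a_\lambda(r_B(x)_{-\mu-\partial}b)+r_B(l_A(b)_\mu x)_{-\lambda-\partial}a$; (3) $l_B(x)_\lambda(a_\mu b)=(l_B(x)_\lambda a)_{\lambda+\mu}b+l_B(r_A(a)_{-\lambda-\partial}x)_{\lambda+\mu}b$; (4) $r_A(l_B(y)_\mu a)_{-\lambda-\partial}x+x_\lambda(r_A(a)_{-\mu-\partial}y)=r_A(a)_{-\lambda-\mu-\partial}(x_\lambda y)$; (5) $r_A(r_B(y)_{-\mu-\partial}a)_{-\lambda-\partial}x+x_\lambda(l_A(a)_\mu y)=l_A(l_B(x)_\lambda a)_{\lambda+\mu}y+(r_A(a)_{-\lambda-\partial}x)_{\lambda+\mu}y$; (6) $a_\lambda(l_B(x)_\mu b)+r_B(r_A(b)_{-\mu-\partial}x)_{-\lambda-\partial}a=(r_B(x)_{-\lambda-\partial}a)_{\lambda+\mu}b+l_B(l_A(a)_\lambda x)_{\lambda+\mu}b$. A conformal bilinear form on a $\mathbb{C}[\partial]$-module $V$ is a $\mathbb{C}$-bilinear map $\langle\cdot,\cdot\rangle_\lambda:V\times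 V\to\mathbb{C}[\lambda]$ with $\langle\partial a,b\rangle_\lambda=-\lambda\langle a,b\rangle_\lambda$, $\langle a,\partial b\rangle_\lambda=\lambda\langle a,b\rangle_\lambda$. It is non-degenerate if $v\mapsto\langle v,\cdot\rangle_\lambda$ is an isomorphism $V\to V^{\ast c}$ of $\mathbb{C}[\partial]$-modules. A Frobenius conformal algebra is an associative conformal algebra with a non-degenerate conformal bilinear form such that $\langle a_\lambda b,c\rangle_\mu=\langle a,b_{\mu-\partial}c\rangle_\lambda$ for all $a,b,c$ (the right side equals $\langle a,b_{\mu-\lambda}c\rangle_\lambda$). A double construction of Frobenius conformal algebra associated to $B$ and $B^{\ast c}$ (both with given associative conformal algebra structures) is a Frobenius conformal algebra which is $B\oplus B^{\ast c}$ as a $\mathbb{C}[\partial]$-module, in which $B$ and $B^{\ast c}$ are associative conformal subalgebras, and whose form is $\langle a+f,b+g\rangle_\lambda=f_\lambda(b)+g_{-\lambda}(a)$ for $a,b\in B$, $f,g\in B^{\ast c}$. *)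

theory Defs
  imports
    Complex_Main
    "HOL-Computational_Algebra.Polynomial"
    "HOL-Library.Product_Plus"
    "HOL-Library.Function_Algebras"
begin

text \<open>
  A \<open>\<complex>[\<partial>]\<close>-module is a \<open>complex poly\<close>-module, given as a submodule \<open>carr\<close> of an ambient
  module on a whole type; \<open>\<partial>\<close> is the polynomial variable \<open>[:0, 1:]\<close>.  The space \<open>V[\<lambda>]\<close> is
  \<open>'v poly\<close>.  Functions on a module matter only on its carrier.
\<close>

record 'v cmodule =
  carr :: "'v set"
  act :: "complex poly \<Rightarrow> 'v \<Rightarrow> 'v"

definition conf_module :: "('v::ab_group_add, 'm) cmodule_scheme \<Rightarrow> bool" where
  "conf_module V \<longleftrightarrow> module (act V) \<and> module.subspace (act V) (carr V)"

definition scl :: "('v, 'm) cmodule_scheme \<Rightarrow> complex \<Rightarrow> 'v \<Rightarrow> 'v" where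
  "scl V c v = act V [:c:] v"

definition der :: "('v, 'm) cmodule_scheme \<Rightarrow> 'v \<Rightarrow> 'v" where
  "der V v = act V [:0, 1:] v"

definition finite_module :: "('v::ab_group_add, 'm) cmodule_scheme \<Rightarrow> bool" where
  "finite_module V \<longleftrightarrow> (\<exists>S. finite S \<and> S \<subseteq> carr V \<and> module.span (act V) S = carr V)"

definition free_module :: "('v::ab_group_add, 'm) cmodule_scheme \<Rightarrow> bool" where
  "free_module V \<longleftrightarrow>
     (\<exists>S. S \<subseteq> carr V \<and> \<not> module.dependent (act V) S \<and> module.span (act V) S = carr V)"

definition cmodule_iso ::
  "('u::ab_group_add, 'm) cmodule_scheme \<Rightarrow> ('v::ab_group_add, 'n) cmodule_scheme
     \<Rightarrow> ('u \<Rightarrow> 'v) \<Rightarrow> bool" where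
  "cmodule_iso U V \<phi> \<longleftrightarrow> bij_betw \<phi> (carr U) (carr V) \<and>
     (\<forall>u\<in>carr U. \<forall>w\<in>carr U. \<phi> (u + w) = \<phi> u + \<phi> w) \<and>
     (\<forall>p. \<forall>u\<in>carr U. \<phi> (act U p u) = act V p (\<phi> u))"

definition direct_sum ::
  "('u, 'm) cmodule_scheme \<Rightarrow> ('v, 'n) cmodule_scheme \<Rightarrow> ('u \<times> 'v) cmodule" where
  "direct_sum U V = \<lparr> carr = carr U \<times> carr V, act = (\<lambda>p (u, v). (act U p u, act V p v)) \<rparr>"


text \<open>
  \<open>psubst V q P\<close> substitutes \<open>q(\<partial>)\<close> for the variable of \<open>P \<in> V[\<nu>]\<close>, with \<open>\<partial>\<close> acting on the
  coefficients.  As \<open>\<complex>\<close> is infinite, an identity in \<open>V[\<lambda>]\<close> or \<open>V[\<lambda>,\<mu>]\<close> is stated as an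
  identity for all complex numbers \<open>\<lambda>\<close>, \<open>\<mu>\<close>: \<open>ev V l\<close> is the value at \<open>\<nu> = \<lambda>\<close>, and \<open>evd V l\<close>
  the value at \<open>\<nu> = -\<lambda>-\<partial>\<close>.
\<close>

definition psubst ::
  "('v::ab_group_add, 'm) cmodule_scheme \<Rightarrow> complex poly \<Rightarrow> 'v poly \<Rightarrow> 'v" where
  "psubst V q P = (\<Sum>k\<le>degree P. act V (q ^ k) (coeff P k))"

definition ev :: "('v::ab_group_add, 'm) cmodule_scheme \<Rightarrow> complex \<Rightarrow> 'v poly \<Rightarrow> 'v" where
  "ev V l P = psubst V [:l:] P"

definition evd :: "('v::ab_group_add, 'm) cmodule_scheme \<Rightarrow> complex \<Rightarrow> 'v poly \<Rightarrow> 'v" where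
  "evd V l P = psubst V [:- l, - 1:] P"

definition clinear_map ::
  "('u::ab_group_add, 'm) cmodule_scheme \<Rightarrow> ('v::ab_group_add, 'n) cmodule_scheme
     \<Rightarrow> ('u \<Rightarrow> 'v poly) \<Rightarrow> bool" where
  "clinear_map U V \<phi> \<longleftrightarrow>
     (\<forall>u\<in>carr U. \<forall>k. coeff (\<phi> u) k \<in> carr V) \<and>
     (\<forall>u\<in>carr U. \<forall>w\<in>carr U. \<phi> (u + w) = \<phi> u + \<phi> w) \<and>
     (\<forall>c. \<forall>u\<in>carr U. \<phi> (scl U c u) = map_poly (scl V c) (\<phi> u))"

definition Chom ::
  "('u::ab_group_add, 'm) cmodule_scheme \<Rightarrow> ('v::ab_group_add, 'n) cmodule_scheme
     \<Rightarrow> ('u \<Rightarrow> 'v poly) set" where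
  "Chom U V = {\<phi>. clinear_map U V \<phi> \<and>
     (\<forall>l. \<forall>u\<in>carr U. ev V l (\<phi> (der U u)) = der V (ev V l (\<phi> u)) + scl V l (ev V l (\<phi> u)))}"

text \<open>\<open>\<complex>[\<partial>]\<close>-module homomorphisms \<open>A \<rightarrow> Cend(M)\<close>, where \<open>(\<partial>\<phi>)\<^sub>\<lambda> = -\<lambda>\<phi>\<^sub>\<lambda>\<close> on \<open>Cend(M)\<close>.\<close>

definition Cend_hom ::
  "('a::ab_group_add, 'm) cmodule_scheme \<Rightarrow> ('v::ab_group_add, 'n) cmodule_scheme
     \<Rightarrow> ('a \<Rightarrow> 'v \<Rightarrow> 'v poly) \<Rightarrow> bool" where
  "Cend_hom A M \<rho> \<longleftrightarrow>
     (\<forall>a\<in>carr A. \<rho> a \<in> Chom M M) \<and>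
     (\<forall>v\<in>carr M. clinear_map A M (\<lambda>a. \<rho> a v)) \<and>
     (\<forall>l. \<forall>a\<in>carr A. \<forall>v\<in>carr M. ev M l (\<rho> (der A a) v) = scl M (- l) (ev M l (\<rho> a v)))"

definition triv_module :: "complex cmodule" where
  "triv_module = \<lparr> carr = UNIV, act = (\<lambda>p c. poly p 0 * c) \<rparr>"

text \<open>
  The elements of the conformal dual are normalised to vanish off the carrier, so that equality
  in the dual is equality of functions.  From \<open>(\<partial>f)\<^sub>\<lambda> = -\<lambda>f\<^sub>\<lambda>\<close> one gets
  \<open>(p(\<partial>)f)\<^sub>\<lambda> = p(-\<lambda>)f\<^sub>\<lambda>\<close>.
\<close>

definition cdual :: "('a::ab_group_add, 'm) cmodule_scheme \<Rightarrow> ('a \<Rightarrow> complex poly) cmodule" where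
  "cdual A = \<lparr> carr = {f \<in> Chom A triv_module. \<forall>a. a \<notin> carr A \<longrightarrow> f a = 0},
               act = (\<lambda>p f a. pcompose p [:0, - 1:] * f a) \<rparr>"


record (overloaded) 'a calgebra = "'a cmodule" +
  lprod :: "'a \<Rightarrow> 'a \<Rightarrow> 'a poly"

abbreviation underlying :: "('a, 'm) calgebra_scheme \<Rightarrow> 'a cmodule" where
  "underlying A \<equiv> cmodule.truncate A"

definition conf_algebra :: "('a::ab_group_add, 'm) calgebra_scheme \<Rightarrow> bool" where
  "conf_algebra A \<longleftrightarrow> conf_module A \<and>
     (\<forall>a\<in>carr A. clinear_map A A (lprod A a)) \<and>
     (\<forall>b\<in>carr A. clinear_map A A (\<lambda>a. lprod A a b)) \<and>
     (\<forall>l. \<forall>a\<in>carr A. \<forall>b\<in>carr A.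
        ev A l (lprod A (der A a) b) = scl A (- l) (ev A l (lprod A a b)) \<and>
        ev A l (lprod A a (der A b)) =
          der A (ev A l (lprod A a b)) + scl A l (ev A l (lprod A a b))) \<and>
     (\<forall>l m. \<forall>a\<in>carr A. \<forall>b\<in>carr A. \<forall>c\<in>carr A.
        ev A (l + m) (lprod A (ev A l (lprod A a b)) c) =
        ev A l (lprod A a (ev A m (lprod A b c))))"

definition conf_subalgebra :: "'a::ab_group_add set \<Rightarrow> ('a, 'm) calgebra_scheme \<Rightarrow> bool" where
  "conf_subalgebra S A \<longleftrightarrow> S \<subseteq> carr A \<and> module.subspace (act A) S \<and>
     (\<forall>a\<in>S. \<forall>b\<in>S. \<forall>k. coeff (lprod A a b) k \<in> S)"

definition bimodule ::
  "('a::ab_group_add, 'm) calgebra_scheme \<Rightarrow> ('v::ab_group_add, 'n) cmodule_scheme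
     \<Rightarrow> ('a \<Rightarrow> 'v \<Rightarrow> 'v poly) \<Rightarrow> ('a \<Rightarrow> 'v \<Rightarrow> 'v poly) \<Rightarrow> bool" where
  "bimodule A M lA rA \<longleftrightarrow> conf_module M \<and> Cend_hom A M lA \<and> Cend_hom A M rA \<and>
     (\<forall>l m. \<forall>a\<in>carr A. \<forall>b\<in>carr A. \<forall>v\<in>carr M.
        ev M (l + m) (lA (ev A l (lprod A a b)) v) = ev M l (lA a (ev M m (lA b v))) \<and>
        evd M (l + m) (rA b (evd M l (rA a v))) = evd M l (rA (ev A m (lprod A a b)) v) \<and>
        ev M l (lA a (evd M m (rA b v))) = evd M (l + m) (rA b (ev M l (lA a v))))"

definition matched_pair ::
  "('a::ab_group_add, 'm) calgebra_scheme \<Rightarrow> ('b::ab_group_add, 'n) calgebra_scheme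
     \<Rightarrow> ('a \<Rightarrow> 'b \<Rightarrow> 'b poly) \<Rightarrow> ('a \<Rightarrow> 'b \<Rightarrow> 'b poly)
     \<Rightarrow> ('b \<Rightarrow> 'a \<Rightarrow> 'a poly) \<Rightarrow> ('b \<Rightarrow> 'a \<Rightarrow> 'a poly) \<Rightarrow> bool" where
  "matched_pair A B lA rA lB rB \<longleftrightarrow>
     conf_algebra A \<and> conf_algebra B \<and> bimodule A B lA rA \<and> bimodule B A lB rB \<and>
     (\<forall>l m. \<forall>a\<in>carr A. \<forall>b\<in>carr A. \<forall>x\<in>carr B. \<forall>y\<in>carr B.
        ev B l (lA a (ev B m (lprod B x y))) =
          ev B (l + m) (lprod B (ev B l (lA a x)) y) +
          ev B (l + m) (lA (evd A l (rB x a)) y) \<and>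
        evd A (l + m) (rB x (ev A l (lprod A a b))) =
          ev A l (lprod A a (evd A m (rB x b))) +
          evd A l (rB (ev B m (lA b x)) a) \<and>
        ev A l (lB x (ev A m (lprod A a b))) =
          ev A (l + m) (lprod A (ev A l (lB x a)) b) +
          ev A (l + m) (lB (evd B l (rA a x)) b) \<and>
        evd B l (rA (ev A m (lB y a)) x) + ev B l (lprod B x (evd B m (rA a y))) =
          evd B (l + m) (rA a (ev B l (lprod B x y))) \<and>
        evd B l (rA (evd A m (rB y a)) x) + ev B l (lprod B x (ev B m (lA a y))) =
          ev B (l + m) (lA (ev A l (lB x a)) y) +
          ev B (l + m) (lprod B (evd B l (rA a x)) y) \<and>
        ev A l (lprod A a (ev A m (lB x b))) + evd A l (rB (evd B m (rA b x)) a) =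
          ev A (l + m) (lprod A (evd A l (rB x a)) b) +
          ev A (l + m) (lB (ev B l (lA a x)) b))"


text \<open>The values \<open>L\<^sub>A(a)\<^sub>\<lambda> b = a\<^sub>\<lambda> b\<close> and \<open>R\<^sub>A(a)\<^sub>\<lambda> b = b\<^bsub>-\<lambda>-\<partial>\<^esub> a\<close> at \<open>\<lambda> = l\<close>.\<close>

definition Lmul :: "('a::ab_group_add, 'm) calgebra_scheme \<Rightarrow> 'a \<Rightarrow> complex \<Rightarrow> 'a \<Rightarrow> 'a" where
  "Lmul A a l b = ev A l (lprod A a b)"

definition Rmul :: "('a::ab_group_add, 'm) calgebra_scheme \<Rightarrow> 'a \<Rightarrow> complex \<Rightarrow> 'a \<Rightarrow> 'a" where
  "Rmul A a l b = evd A l (lprod A b a)"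

text \<open>
  \<open>dual_op A T a f\<close> is the polynomial \<open>T\<^sup>*(a)\<^sub>\<lambda> f\<close> in \<open>A\<^sup>*[\<lambda>]\<close> determined by
  \<open>(T\<^sup>*(a)\<^sub>\<lambda> f)\<^sub>\<mu> b = f\<^bsub>\<mu>-\<lambda>\<^esub>(T(a)\<^sub>\<lambda> b)\<close>.  For an algebra structure \<open>D\<close> on the conformal dual
  of \<open>A\<close>, \<open>codual_op A D T f a\<close> is the polynomial \<open>T\<^sup>*(f)\<^sub>\<lambda> a\<close> in \<open>A[\<lambda>]\<close> determined, under
  the identification of \<open>A\<close> with its bidual by \<open>a\<^sub>\<mu>(h) = h\<^bsub>-\<mu>\<^esub>(a)\<close>, by
  \<open>h\<^bsub>-\<mu>\<^esub>(T\<^sup>*(f)\<^sub>\<lambda> a) = (T(f)\<^sub>\<lambda> h)\<^bsub>\<lambda>-\<mu>\<^esub>(a)\<close>.  These polynomials exist and are unique when \<open>A\<close>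
  is finite and free.
\<close>

definition dual_op ::
  "('a::ab_group_add, 'm) cmodule_scheme \<Rightarrow> ('a \<Rightarrow> complex \<Rightarrow> 'a \<Rightarrow> 'a)
     \<Rightarrow> 'a \<Rightarrow> ('a \<Rightarrow> complex poly) \<Rightarrow> ('a \<Rightarrow> complex poly) poly" where
  "dual_op A T a f = (THE P. (\<forall>k. coeff P k \<in> carr (cdual A)) \<and>
     (\<forall>l m. \<forall>b\<in>carr A. poly (ev (cdual A) l P b) m = poly (f (T a l b)) (m - l)))"

definition codual_op ::
  "('a::ab_group_add, 'm) cmodule_scheme \<Rightarrow> ('a \<Rightarrow> complex poly, 'n) cmodule_scheme
     \<Rightarrow> (('a \<Rightarrow> complex poly) \<Rightarrow> complex \<Rightarrow> ('a \<Rightarrow> complex poly) \<Rightarrow> 'a \<Rightarrow> complex poly)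
     \<Rightarrow> ('a \<Rightarrow> complex poly) \<Rightarrow> 'a \<Rightarrow> 'a poly" where
  "codual_op A D T f a = (THE P. (\<forall>k. coeff P k \<in> carr A) \<and>
     (\<forall>l m. \<forall>h\<in>carr D. poly (h (ev A l P)) (- m) = poly (T f l h a) (l - m)))"


definition conf_form ::
  "('v::ab_group_add, 'm) cmodule_scheme \<Rightarrow> ('v \<Rightarrow> 'v \<Rightarrow> complex poly) \<Rightarrow> bool" where
  "conf_form V F \<longleftrightarrow>
     (\<forall>a\<in>carr V. clinear_map V triv_module (F a)) \<and>
     (\<forall>b\<in>carr V. clinear_map V triv_module (\<lambda>a. F a b)) \<and>
     (\<forall>a\<in>carr V. \<forall>b\<in>carr V.
        F (der V a) b = - ([:0, 1:] * F a b) \<and> F a (der V b) = [:0, 1:] * F a b)"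

definition nondegenerate ::
  "('v::ab_group_add, 'm) cmodule_scheme \<Rightarrow> ('v \<Rightarrow> 'v \<Rightarrow> complex poly) \<Rightarrow> bool" where
  "nondegenerate V F \<longleftrightarrow>
     cmodule_iso V (cdual V) (\<lambda>v w. if w \<in> carr V then F v w else 0)"

definition frobenius ::
  "('a::ab_group_add, 'm) calgebra_scheme \<Rightarrow> ('a \<Rightarrow> 'a \<Rightarrow> complex poly) \<Rightarrow> bool" where
  "frobenius A F \<longleftrightarrow> conf_algebra A \<and> conf_form A F \<and> nondegenerate A F \<and>
     (\<forall>l m. \<forall>a\<in>carr A. \<forall>b\<in>carr A. \<forall>c\<in>carr A.
        poly (F (ev A l (lprod A a b)) c) m =
        poly (F a (psubst A [:m, - 1:] (lprod A b c))) l)"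

definition pairing_form ::
  "'a \<times> ('a \<Rightarrow> complex poly) \<Rightarrow> 'a \<times> ('a \<Rightarrow> complex poly) \<Rightarrow> complex poly" where
  "pairing_form = (\<lambda>(a, f) (b, g). f b + pcompose (g a) [:0, - 1:])"

definition double_construction ::
  "('a::ab_group_add, 'm) calgebra_scheme \<Rightarrow> ('a \<Rightarrow> complex poly, 'n) calgebra_scheme
     \<Rightarrow> ('a \<times> ('a \<Rightarrow> complex poly), 'k) calgebra_scheme \<Rightarrow> bool" where
  "double_construction B D E \<longleftrightarrow>
     frobenius E pairing_form \<and>
     underlying E = direct_sum B D \<and>
     conf_subalgebra ((\<lambda>b. (b, 0)) ` carr B) E \<and>
     conf_subalgebra ((\<lambda>f. (0, f)) ` carr D) E \<and>
     (\<forall>a\<in>carr B. \<forall>b\<in>carr B.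
        lprod E (a, 0) (b, 0) = map_poly (\<lambda>c. (c, 0)) (lprod B a b)) \<and>
     (\<forall>f\<in>carr D. \<forall>g\<in>carr D.
        lprod E (0, f) (0, g) = map_poly (\<lambda>h. (0, h)) (lprod D f g))"

end

theory Submission
  imports Defs
begin

text \<open>
  On \<open>A \<oplus> A\<^sup>*\<close> consider the product
  \<open>(a + f)\<^sub>\<lambda>(b + g) = (a\<^sub>\<lambda>b + l\<^sub>B(f)\<^sub>\<lambda>b + r\<^sub>B(g)\<^bsub>-\<lambda>-\<partial>\<^esub>a) + (f\<^sub>\<lambda>g + l\<^sub>A(a)\<^sub>\<lambda>g + r\<^sub>A(b)\<^bsub>-\<lambda>-\<partial>\<^esub>f)\<close>.
  Comparing the two components of the associator on the eight types of homogeneous triples shows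
  that it is associative iff the six maps form a matched pair.  For the duals of the
  multiplication operators this product makes the pairing invariant; conversely,
  invariance and non-degeneracy force the mixed products of a double construction to be
  the ones above.  Freeness and finiteness give a dual basis, hence the existence of the dual
  operators as polynomials in \<open>\<lambda>\<close> and the identification of \<open>A\<close> with its bidual.
\<close>

subsection \<open>Polynomial functions and semilinear maps\<close>

text \<open>The obstacle is a substitution such as -\<lambda>-\<partial>, in which a formal variable
  becomes an operator. It disappears under functionals: the value of h at m satisfies h(\<partial>x)
  = m h(x), so inside it \<partial> is the number m; on the dual, with the argument x and m fixed,
  \<partial> is -m. Identities in A and in its dual are therefore tested on such scalars, which
  separate the elements of A because of the dual basis. There the mixed operators become values of
  the two given products, and invariance of the pairing is a termwise match of six scalars with six
  scalars. The predicate \<open>semilin U V r\<close> covers all the rules at once: \<partial>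
  becomes r(\<partial>) under the map. The choice r = \<lambda>+\<partial> is the rule in a right
  factor, r = -\<lambda> the rule in a left factor, and a constant r the value of a functional. The
  transpose of right multiplication acts on the left because invariance rotates the pairing of
  \<open>a\<close> times \<open>g\<close> with \<open>b\<close> into the pairing of \<open>g\<close>
  with \<open>b\<close> times \<open>a\<close>, and symmetrically for the other side.\<close>

definition semilin ::
  "('u::ab_group_add, 'm) cmodule_scheme \<Rightarrow> ('v::ab_group_add, 'n) cmodule_scheme
     \<Rightarrow> complex poly \<Rightarrow> ('u \<Rightarrow> 'v) \<Rightarrow> bool" where
  "semilin U V r \<phi> \<longleftrightarrow> (\<forall>u\<in>carr U. \<phi> u \<in> carr V) \<and>
     (\<forall>u\<in>carr U. \<forall>w\<in>carr U. \<phi> (u + w) = \<phi> u + \<phi> w) \<and>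
     (\<forall>p. \<forall>u\<in>carr U. \<phi> (act U p u) = act V (pcompose p r) (\<phi> u))"

text \<open>\<open>dual_op\<close> and \<open>codual_op\<close> describe a polynomial by its values.
  The description is proper only if the family of values comes from some polynomial with
  coefficients in the carrier, and this is the property that has to be carried through every
  construction.\<close>

definition polyf :: "('v::ab_group_add, 'm) cmodule_scheme \<Rightarrow> (complex \<Rightarrow> 'v) \<Rightarrow> bool" where
  "polyf V g \<longleftrightarrow> (\<exists>P. (\<forall>k. coeff P k \<in> carr V) \<and> (\<forall>l. ev V l P = g l))"

lemma semilin_closed: "semilin U V r \<phi> \<Longrightarrow> u \<in> carr U \<Longrightarrow> \<phi> u \<in> carr V"
  by (simp add: semilin_def)

lemma semilin_add:
  "semilin U V r \<phi> \<Longrightarrow> u \<in> carr U \<Longrightarrow> w \<in> carr U \<Longrightarrow> \<phi> (u + w) = \<phi> u + \<phi> w"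
  by (simp add: semilin_def)

lemma semilin_act:
  "semilin U V r \<phi> \<Longrightarrow> u \<in> carr U \<Longrightarrow> \<phi> (act U p u) = act V (pcompose p r) (\<phi> u)"
  by (simp add: semilin_def)

lemma semilin_cong:
  assumes "semilin U V r \<phi>" "\<And>u. u \<in> carr U \<Longrightarrow> \<psi> u = \<phi> u" "conf_module U"
  shows "semilin U V r \<psi>"
  using assms module.subspace_def[of "act U" "carr U"]
  by (auto simp: semilin_def conf_module_def)

section \<open>Evaluation of polynomials with coefficients in a module\<close>

locale conf_mod =
  fixes V :: "('v::ab_group_add, 'm) cmodule_scheme"
  assumes conf_module: "conf_module V"
begin

sublocale module "act V"
  using conf_module by (simp add: conf_module_def)

lemma carr_subspace: "subspace (carr V)"
  using conf_module by (simp add: conf_module_def)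

lemma carr_closed [simp, intro]:
  "0 \<in> carr V"
  "x \<in> carr V \<Longrightarrow> y \<in> carr V \<Longrightarrow> x + y \<in> carr V"
  "x \<in> carr V \<Longrightarrow> act V p x \<in> carr V"
  using carr_subspace by (auto simp: subspace_def)

lemma carr_sum [intro]: "(\<And>i. i \<in> I \<Longrightarrow> x i \<in> carr V) \<Longrightarrow> sum x I \<in> carr V"
  using carr_subspace by (rule subspace_sum)

lemma psubst_bound:
  assumes "degree P \<le> n"
  shows "psubst V q P = (\<Sum>k\<le>n. act V (q ^ k) (coeff P k))"
  unfolding psubst_def
  by (rule sum.mono_neutral_left) (use assms in \<open>auto simp: coeff_eq_0\<close>)

lemma psubst_0 [simp]: "psubst V q 0 = 0"
  by (simp add: psubst_def)

lemma psubst_add: "psubst V q (P + Q) = psubst V q P + psubst V q Q"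
proof -
  let ?n = "max (degree P) (degree Q)"
  have "degree (P + Q) \<le> ?n" by (rule degree_add_le_max)
  then show ?thesis
    by (simp add: psubst_bound[of _ ?n] scale_right_distrib sum.distrib)
qed

lemma psubst_pCons: "psubst V q (pCons c P) = c + act V q (psubst V q P)"
proof -
  have "degree (pCons c P) \<le> Suc (degree P)" by (rule degree_pCons_le)
  then have "psubst V q (pCons c P) = (\<Sum>k\<le>Suc (degree P). act V (q ^ k) (coeff (pCons c P) k))"
    by (rule psubst_bound)
  also have "\<dots> = c + (\<Sum>k\<le>degree P. act V (q * q ^ k) (coeff P k))"
    by (subst sum.atMost_Suc_shift) simp
  also have "\<dots> = c + act V q (psubst V q P)"
    by (simp add: psubst_def scale_sum_right)
  finally show ?thesis .
qed

lemma psubst_closed: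
  assumes "\<And>k. coeff P k \<in> carr V"
  shows "psubst V q P \<in> carr V"
  unfolding psubst_def using assms by auto

lemma ev_closed: "(\<And>k. coeff P k \<in> carr V) \<Longrightarrow> ev V l P \<in> carr V"
  unfolding ev_def by (rule psubst_closed)

lemma evd_closed: "(\<And>k. coeff P k \<in> carr V) \<Longrightarrow> evd V l P \<in> carr V"
  unfolding evd_def by (rule psubst_closed)

lemma psubst_map_act: "psubst V q (map_poly (act V p) P) = act V p (psubst V q P)"
proof -
  have "degree (map_poly (act V p) P) \<le> degree P" by (rule map_poly_degree_leq)
  then show ?thesis
    by (simp add: psubst_bound[of _ "degree P"] coeff_map_poly scale_sum_right mult.commute)
qed

text \<open>Replacing \<open>g l\<close> by \<open>g (2 * l) - 2 ^ Suc n * g l\<close> removes the leading term of \<open>g\<close>.\<close>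

lemma polynomial_coeffs_unique:
  assumes "\<And>l. (\<Sum>k\<le>n. act V [:l ^ k:] (x k)) = 0" "k \<le> n"
  shows "x k = 0"
  using assms
proof (induction n arbitrary: x k)
  case 0
  from "0.prems"(1)[of 0] "0.prems"(2) show ?case
    by (simp flip: one_pCons)
next
  case (Suc n)
  define N where "N = Suc n"
  \<comment> \<open>A module over polynomials may have torsion, but nonzero constants are units and
    kill nothing.\<close>
  have unit: "y = 0" if "act V [:c:] y = 0" "c \<noteq> 0" for c y
  proof -
    have "y = act V [:inverse c:] (act V [:c:] y)"
      using that(2) by (simp flip: one_pCons)
    then show ?thesis using that(1) by simp
  qed
  have low: "x k = 0" if k: "k \<le> n" for k
  proof -
    have "(\<Sum>k\<le>n. act V [:l ^ k:] (act V [:2 ^ k - 2 ^ N:] (x k))) = 0" for l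
    proof -
      have "act V [:(2 * l) ^ k:] (x k) - act V [:2 ^ N:] (act V [:l ^ k:] (x k)) =
          act V [:l ^ k:] (act V [:2 ^ k - 2 ^ N:] (x k))" for k
      proof -
        have "act V [:(2 * l) ^ k:] (x k) - act V [:2 ^ N:] (act V [:l ^ k:] (x k)) =
            act V ([:(2 * l) ^ k:] - [:2 ^ N:] * [:l ^ k:]) (x k)"
          by (simp only: scale_left_diff_distrib scale_scale)
        also have "[:(2 * l) ^ k:] - [:2 ^ N:] * [:l ^ k:] = [:l ^ k:] * [:2 ^ k - 2 ^ N:]"
          by (simp add: power_mult_distrib algebra_simps)
        finally show ?thesis by simp
      qed
      then have "(\<Sum>k\<le>N. act V [:l ^ k:] (act V [:2 ^ k - 2 ^ N:] (x k))) =
          (\<Sum>k\<le>N. act V [:(2 * l) ^ k:] (x k)) - act V [:2 ^ N:] (\<Sum>k\<le>N. act V [:l ^ k:] (x k))"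
        by (simp only: scale_sum_right sum_subtractf[symmetric])
      then show ?thesis
        using Suc.prems(1)[of l] Suc.prems(1)[of "2 * l"] by (simp add: N_def)
    qed
    from Suc.IH[OF this k] have "act V [:2 ^ k - 2 ^ N:] (x k) = 0" .
    moreover have "(2::complex) ^ k \<noteq> 2 ^ N"
    proof
      assume "(2::complex) ^ k = 2 ^ N"
      then have "of_nat (2 ^ k) = (of_nat (2 ^ N) :: complex)" by simp
      then have "(2::nat) ^ k = 2 ^ N" by (simp only: of_nat_eq_iff)
      then show False using k by (simp add: N_def del: power_Suc)
    qed
    ultimately show ?thesis using unit by auto
  qed
  have "act V [:1 ^ Suc n:] (x (Suc n)) = 0"
    using Suc.prems(1)[of 1] low by (simp flip: one_pCons)
  then have "x (Suc n) = 0" by (simp flip: one_pCons)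
  then show ?case using low Suc.prems(2) by (auto simp: le_Suc_eq)
qed

lemma pCons_power: "[:l:] ^ k = [:l ^ k:]" for l :: complex
  by (induction k) (auto simp: one_pCons)

text \<open>This makes identities stated for all complex \<lambda> into identities of polynomials:
  the difference vanishes at every scalar, so each of its coefficients does.\<close>

lemma ev_inject:
  assumes "\<And>l. ev V l P = ev V l Q"
  shows "P = Q"
proof (rule poly_eqI)
  fix k
  \<comment> \<open>Including \<open>k\<close> in the bound keeps index \<open>k\<close> in the
    range of the sum even beyond both degrees.\<close>
  let ?n = "max k (max (degree P) (degree Q))"
  have "(\<Sum>k\<le>?n. act V [:l ^ k:] (coeff P k - coeff Q k)) = 0" for l
    using assms[of l]
    by (simp add: ev_def psubst_bound[of P ?n] psubst_bound[of Q ?n] scale_right_diff_distrib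
        sum_subtractf pCons_power)
  then have "coeff P k - coeff Q k = 0"
    by (rule polynomial_coeffs_unique) simp
  then show "coeff P k = coeff Q k" by simp
qed

lemma ev_add: "ev V l (P + Q) = ev V l P + ev V l Q"
  by (simp add: ev_def psubst_add)

lemma evd_add: "evd V l (P + Q) = evd V l P + evd V l Q"
  by (simp add: evd_def psubst_add)

lemma ev_pCons: "ev V l (pCons c P) = c + act V [:l:] (ev V l P)"
  by (simp add: ev_def psubst_pCons)

lemma ev_map_act: "ev V l (map_poly (act V p) P) = act V p (ev V l P)"
  by (simp add: ev_def psubst_map_act)

lemma ev_const: "ev V l [:c:] = c"
  by (simp add: ev_pCons) (simp add: ev_def)

lemma coeff_pCons_closed:
  "c \<in> carr V \<Longrightarrow> (\<And>k. coeff P k \<in> carr V) \<Longrightarrow> coeff (pCons c P) k \<in> carr V"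
  by (cases k) auto

lemma polyf_const [intro]: "c \<in> carr V \<Longrightarrow> polyf V (\<lambda>l. c)"
  unfolding polyf_def by (rule exI[of _ "[:c:]"]) (auto simp: ev_const coeff_pCons split: nat.splits)

lemma polyf_add [intro]: "polyf V g \<Longrightarrow> polyf V h \<Longrightarrow> polyf V (\<lambda>l. g l + h l)"
  unfolding polyf_def
proof (elim exE conjE)
  fix P Q
  assume "\<forall>k. coeff P k \<in> carr V" "\<forall>l. ev V l P = g l" "\<forall>k. coeff Q k \<in> carr V" "\<forall>l. ev V l Q = h l"
  then show "\<exists>P. (\<forall>k. coeff P k \<in> carr V) \<and> (\<forall>l. ev V l P = g l + h l)"
    by (intro exI[of _ "P + Q"]) (auto simp: ev_add)
qed

lemma polyf_sum [intro]:
  "finite I \<Longrightarrow> (\<And>i. i \<in> I \<Longrightarrow> polyf V (g i)) \<Longrightarrow> polyf V (\<lambda>l. \<Sum>i\<in>I. g i l)"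
  by (induction I rule: finite_induct) auto

lemma polyf_shift [intro]: "polyf V g \<Longrightarrow> polyf V (\<lambda>l. act V [:l:] (g l))"
  unfolding polyf_def
proof (elim exE conjE)
  fix P
  assume "\<forall>k. coeff P k \<in> carr V" "\<forall>l. ev V l P = g l"
  then show "\<exists>P. (\<forall>k. coeff P k \<in> carr V) \<and> (\<forall>l. ev V l P = act V [:l:] (g l))"
    by (intro exI[of _ "pCons 0 P"]) (auto simp: ev_pCons coeff_pCons_closed)
qed

lemma polyf_ev: "(\<And>k. coeff P k \<in> carr V) \<Longrightarrow> polyf V (\<lambda>l. ev V l P)"
  by (auto simp: polyf_def)

text \<open>Uniqueness is \<open>ev_inject\<close>. The shape is that of the descriptions defining
  the dual operators, so that \<open>theI'\<close> applies to them.\<close>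

lemma ex1_polyf:
  assumes "polyf V g"
  shows "\<exists>!P. (\<forall>k. coeff P k \<in> carr V) \<and> (\<forall>l. ev V l P = g l)"
  using assms unfolding polyf_def
proof (elim exE, intro ex_ex1I)
  show "P = Q" if "(\<forall>k. coeff P k \<in> carr V) \<and> (\<forall>l. ev V l P = g l)"
    "(\<forall>k. coeff Q k \<in> carr V) \<and> (\<forall>l. ev V l Q = g l)" for P Q
    using that by (intro ev_inject) auto
qed blast

end

section \<open>Substitution under semilinear maps\<close>

lemma psubst_semilin:
  assumes U: "conf_module U" and V: "conf_module V" and \<phi>: "semilin U V r \<phi>"
    and P: "\<And>k. coeff P k \<in> carr U"
  shows "\<phi> (psubst U q P) = psubst V (pcompose q r) (map_poly \<phi> P)"
proof -
  interpret U: conf_mod U by unfold_locales fact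
  interpret V: conf_mod V by unfold_locales fact
  have \<phi>0: "\<phi> 0 = 0" using semilin_add[OF \<phi>, of 0 0] by simp
  show ?thesis using P
  proof (induction P)
    case 0
    then show ?case by (simp add: \<phi>0)
  next
    case (pCons c P)
    have c: "c \<in> carr U" using pCons.prems[of 0] by simp
    have P: "coeff P k \<in> carr U" for k using pCons.prems[of "Suc k"] by simp
    have "\<phi> (psubst U q (pCons c P)) = \<phi> c + \<phi> (act U q (psubst U q P))"
      using c U.psubst_closed[OF P] by (simp add: U.psubst_pCons semilin_add[OF \<phi>])
    also have "\<dots> = \<phi> c + act V (pcompose q r) (psubst V (pcompose q r) (map_poly \<phi> P))"
      using U.psubst_closed[OF P] pCons.IH[OF P] by (simp add: semilin_act[OF \<phi>])
    also have "\<dots> = psubst V (pcompose q r) (map_poly \<phi> (pCons c P))"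
      by (simp add: map_poly_pCons \<phi>0 V.psubst_pCons)
    finally show ?case .
  qed
qed

text \<open>A scalar \<open>[:l:]\<close> is unchanged by composition with \<open>r\<close>, so
  evaluation at a number commutes with every semilinear map.\<close>

lemma ev_semilin:
  assumes "conf_module U" "conf_module V" "semilin U V r \<phi>" "\<And>k. coeff P k \<in> carr U"
  shows "\<phi> (ev U l P) = ev V l (map_poly \<phi> P)"
  unfolding ev_def by (subst psubst_semilin[OF assms]) auto

lemma polyf_semilin:
  assumes U: "conf_module U" and V: "conf_module V" and \<phi>: "semilin U V r \<phi>" and g: "polyf U g"
  shows "polyf V (\<lambda>l. \<phi> (g l))"
proof -
  obtain P where P: "\<And>k. coeff P k \<in> carr U" and gl: "\<And>l. ev U l P = g l"
    using g unfolding polyf_def by blast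
  have "\<phi> 0 = 0"
    using semilin_add[OF \<phi>, of 0 0] conf_mod.carr_closed(1)[of U] U by (simp add: conf_mod_def)
  moreover have "\<phi> (g l) = ev V l (map_poly \<phi> P)" for l
    using ev_semilin[OF U V \<phi> P] gl by metis
  ultimately show ?thesis
    using semilin_closed[OF \<phi> P] unfolding polyf_def
    by (intro exI[of _ "map_poly \<phi> P"]) (auto simp: coeff_map_poly)
qed

text \<open>A constant \<open>r\<close> turns \<partial> into the number \<open>c\<close>, hence
  q(\<partial>) into the number \<open>poly q c\<close>. This is how all operator substitutions are
  removed below.\<close>

lemma psubst_point:
  assumes "conf_module U" "conf_module V" "semilin U V [:c:] \<phi>" "\<And>k. coeff P k \<in> carr U"
  shows "\<phi> (psubst U q P) = \<phi> (ev U (poly q c) P)"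
  unfolding ev_def by (subst (1 2) psubst_semilin[OF assms]) (auto simp: pcompose_pCons_0)

text \<open>Since \<open>\<complex>[\<partial>]\<close> is generated by the constants and \<open>\<partial>\<close>, semilinearity is checked on these.\<close>

lemma semilinI:
  assumes U: "conf_module U" and V: "conf_module V"
    and "\<And>u. u \<in> carr U \<Longrightarrow> \<phi> u \<in> carr V"
    and add: "\<And>u w. u \<in> carr U \<Longrightarrow> w \<in> carr U \<Longrightarrow> \<phi> (u + w) = \<phi> u + \<phi> w"
    and scl: "\<And>c u. u \<in> carr U \<Longrightarrow> \<phi> (scl U c u) = scl V c (\<phi> u)"
    and der: "\<And>u. u \<in> carr U \<Longrightarrow> \<phi> (der U u) = act V r (\<phi> u)"
  shows "semilin U V r \<phi>"
proof -
  interpret U: conf_mod U by unfold_locales fact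
  interpret V: conf_mod V by unfold_locales fact
  have "\<phi> (act U p u) = act V (pcompose p r) (\<phi> u)" if u: "u \<in> carr U" for p u
  proof (induction p)
    case 0
    show ?case using add[of 0 0] by simp
  next
    case (pCons c p)
    have "act U (pCons c p) u = scl U c u + der U (act U p u)"
      by (simp add: scl_def der_def flip: U.scale_left_distrib)
    then have "\<phi> (act U (pCons c p) u) = \<phi> (scl U c u) + \<phi> (der U (act U p u))"
      using u by (simp add: add scl_def der_def)
    also have "\<dots> = act V [:c:] (\<phi> u) + act V r (act V (pcompose p r) (\<phi> u))"
      using u pCons.IH by (simp add: scl der) (simp add: scl_def)
    finally show ?case
      by (simp add: pcompose_pCons V.scale_left_distrib)
  qed
  then show ?thesis using assms by (simp add: semilin_def)
qed

text \<open>Bridge from the definitional form, linearity of polynomials together with a rule for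
  \<partial>, to semilinearity at each \<lambda>. One direction is \<open>semilinI\<close>; the
  other recovers polynomials from their values. The multiplier \<open>r l\<close> stays abstract so
  that the rules for \<lambda>+\<partial>, -\<lambda> and \<lambda> are all instances.\<close>

lemma clinear_map_der_iff:
  assumes U: "conf_module U" and V: "conf_module V"
  shows "clinear_map U V \<phi> \<and>
      (\<forall>l. \<forall>u\<in>carr U. ev V l (\<phi> (der U u)) = act V (r l) (ev V l (\<phi> u))) \<longleftrightarrow>
    (\<forall>u\<in>carr U. \<forall>k. coeff (\<phi> u) k \<in> carr V) \<and>
    (\<forall>l. semilin U V (r l) (\<lambda>u. ev V l (\<phi> u)))" (is "?L \<longleftrightarrow> ?R")
proof
  interpret U: conf_mod U by unfold_locales fact
  interpret V: conf_mod V by unfold_locales fact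
  have scl_ev: "ev V l (map_poly (scl V c) P) = scl V c (ev V l P)" for l c P
    using V.ev_map_act[of l "[:c:]" P] by (simp add: scl_def[abs_def])
  {
    assume L: ?L
    have "semilin U V (r l) (\<lambda>u. ev V l (\<phi> u))" for l
      using L by (intro semilinI[OF U V]) (auto simp: clinear_map_def V.ev_closed V.ev_add scl_ev)
    then show ?R using L by (auto simp: clinear_map_def)
  next
    assume R: ?R
    have "\<phi> (u + w) = \<phi> u + \<phi> w" if "u \<in> carr U" "w \<in> carr U" for u w
      using R that by (intro V.ev_inject) (auto simp: V.ev_add semilin_def)
    moreover have "\<phi> (scl U c u) = map_poly (scl V c) (\<phi> u)" if "u \<in> carr U" for c u
      using R that by (intro V.ev_inject) (auto simp: scl_ev semilin_def, simp add: scl_def)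
    moreover have "ev V l (\<phi> (der U u)) = act V (r l) (ev V l (\<phi> u))" if "u \<in> carr U" for l u
      using R that by (auto simp: semilin_def der_def pcompose_pCons)
    ultimately show ?L using R by (auto simp: clinear_map_def)
  }
qed

lemma Chom_iff:
  assumes U: "conf_module U" and V: "conf_module V"
  shows "\<phi> \<in> Chom U V \<longleftrightarrow>
    (\<forall>u\<in>carr U. \<forall>k. coeff (\<phi> u) k \<in> carr V) \<and>
    (\<forall>l. semilin U V [:l, 1:] (\<lambda>u. ev V l (\<phi> u)))"
proof -
  interpret V: conf_mod V by unfold_locales fact
  have "der V x + scl V l x = act V [:l, 1:] x" for l x
    by (simp add: der_def scl_def flip: V.scale_left_distrib)
  then show ?thesis
    by (simp add: Chom_def flip: clinear_map_der_iff[OF U V, of \<phi> "\<lambda>l. [:l, 1:]"])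
qed

section \<open>Sesquilinear operators\<close>

definition Cend_hom_form ::
  "('a::ab_group_add, 'm) cmodule_scheme \<Rightarrow> ('v::ab_group_add, 'n) cmodule_scheme
     \<Rightarrow> ('a \<Rightarrow> 'v \<Rightarrow> 'v poly) \<Rightarrow> bool" where
  "Cend_hom_form A M \<rho> \<longleftrightarrow>
    (\<forall>a\<in>carr A. \<forall>v\<in>carr M. \<forall>k. coeff (\<rho> a v) k \<in> carr M) \<and>
    (\<forall>l. \<forall>a\<in>carr A. semilin M M [:l, 1:] (\<lambda>v. ev M l (\<rho> a v))) \<and>
    (\<forall>l. \<forall>v\<in>carr M. semilin A M [:- l:] (\<lambda>a. ev M l (\<rho> a v)))"

lemma Cend_hom_iff:
  assumes A: "conf_module A" and M: "conf_module M"
  shows "Cend_hom A M \<rho> \<longleftrightarrow> Cend_hom_form A M \<rho>"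
proof -
  have "Cend_hom A M \<rho> \<longleftrightarrow> (\<forall>a\<in>carr A. \<rho> a \<in> Chom M M) \<and>
     (\<forall>v\<in>carr M. clinear_map A M (\<lambda>a. \<rho> a v) \<and>
       (\<forall>l. \<forall>a\<in>carr A. ev M l (\<rho> (der A a) v) = act M [:- l:] (ev M l (\<rho> a v))))"
    by (auto simp: Cend_hom_def scl_def)
  also have "\<dots> \<longleftrightarrow> (\<forall>a\<in>carr A. \<rho> a \<in> Chom M M) \<and>
     (\<forall>v\<in>carr M. (\<forall>a\<in>carr A. \<forall>k. coeff (\<rho> a v) k \<in> carr M) \<and>
       (\<forall>l. semilin A M [:- l:] (\<lambda>a. ev M l (\<rho> a v))))"
    by (simp only: clinear_map_der_iff[OF A M, of "\<lambda>a. \<rho> a v" "\<lambda>l. [:- l:]" for v])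
  also have "\<dots> \<longleftrightarrow> Cend_hom_form A M \<rho>"
    unfolding Chom_iff[OF M M] Cend_hom_form_def by blast
  finally show ?thesis .
qed

text \<open>A product is sesquilinear in the same way as an action of the algebra on itself, so
  every fact about operators \<open>A\<close> to \<open>Cend M\<close> also serves for
  \<open>lprod\<close>.\<close>

lemma conf_algebra_iff:
  "conf_algebra A \<longleftrightarrow> conf_module A \<and> Cend_hom A A (lprod A) \<and>
     (\<forall>l m. \<forall>a\<in>carr A. \<forall>b\<in>carr A. \<forall>c\<in>carr A.
        ev A (l + m) (lprod A (ev A l (lprod A a b)) c) =
        ev A l (lprod A a (ev A m (lprod A b c))))"
  by (auto simp: conf_algebra_def Cend_hom_def Chom_def)

text \<open>The substitution \<open>\<lambda> \<mapsto> -\<lambda>-\<partial>\<close> interchanges the two sesquilinearity rules.\<close>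

lemma semilin_evd:
  assumes U: "conf_module U" and V: "conf_module V"
    and coeffs: "\<And>u k. u \<in> carr U \<Longrightarrow> coeff (\<phi> u) k \<in> carr V"
    and \<phi>: "\<And>l. semilin U V [:s * l, t:] (\<lambda>u. ev V l (\<phi> u))"
  shows "semilin U V [:- s * l, t - s:] (\<lambda>u. evd V l (\<phi> u))"
proof -
  interpret U: conf_mod U by unfold_locales fact
  interpret V: conf_mod V by unfold_locales fact
  have *: "clinear_map U V \<phi> \<and>
      (\<forall>l. \<forall>u\<in>carr U. ev V l (\<phi> (der U u)) = act V [:s * l, t:] (ev V l (\<phi> u)))"
    unfolding clinear_map_der_iff[OF U V, of \<phi> "\<lambda>l. [:s * l, t:]"] using coeffs \<phi> by blast
  \<comment> \<open>The rule is known only at scalars. It has to become an identity of polynomials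
    in \<nu>, with factor s\<nu> + t\<partial>, before \<nu> = -\<lambda>-\<partial> can be
    inserted; the factor is then -s\<lambda> + (t-s)\<partial>. Multiplication by \<nu> is
    \<open>pCons 0\<close>.\<close>
  have der_eq: "\<phi> (der U u) =
      map_poly (act V [:s:]) (pCons 0 (\<phi> u)) + map_poly (act V [:0, t:]) (\<phi> u)"
    if u: "u \<in> carr U" for u
  proof (rule V.ev_inject)
    fix l
    show "ev V l (\<phi> (der U u)) =
        ev V l (map_poly (act V [:s:]) (pCons 0 (\<phi> u)) + map_poly (act V [:0, t:]) (\<phi> u))"
      using * u by (simp add: V.ev_add V.ev_map_act V.ev_pCons mult.commute flip: V.scale_left_distrib)
  qed
  have scl_evd: "evd V l (map_poly (scl V c) P) = scl V c (evd V l P)" for c P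
    using V.psubst_map_act[of "[:- l, - 1:]" "[:c:]" P] by (simp add: scl_def[abs_def] evd_def)
  show ?thesis
  proof (rule semilinI[OF U V])
    fix u assume u: "u \<in> carr U"
    have "evd V l (\<phi> (der U u)) =
        act V ([:s:] * [:- l, - 1:] + [:0, t:]) (evd V l (\<phi> u))"
      using u by (simp only: evd_def der_eq V.psubst_add V.psubst_map_act V.psubst_pCons
          V.scale_left_distrib V.scale_scale add_0_left)
    then show "evd V l (\<phi> (der U u)) = act V [:- s * l, t - s:] (evd V l (\<phi> u))"
      by (simp add: mult.commute)
  qed (use * in \<open>auto simp: clinear_map_def scl_evd V.evd_closed V.evd_add\<close>)
qed

text \<open>Horner's scheme: each step multiplies by -\<lambda>-\<partial>, which splits into a
  multiplication by \<lambda>, realised by \<open>polyf_shift\<close>, and the action of a fixed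
  polynomial in \<partial>.\<close>

lemma (in conf_mod) polyf_evd:
  assumes "\<And>k. coeff P k \<in> carr V"
  shows "polyf V (\<lambda>l. evd V l P)"
  using assms
proof (induction P)
  case 0
  then show ?case by (auto simp: evd_def)
next
  case (pCons c P)
  have c: "c \<in> carr V" using pCons.prems[of 0] by simp
  have P: "coeff P k \<in> carr V" for k using pCons.prems[of "Suc k"] by simp
  have g: "polyf V (\<lambda>l. evd V l P)" using pCons.IH P by blast
  have act_g: "polyf V (\<lambda>l. act V [:k:] (h l))" "polyf V (\<lambda>l. act V [:0, k:] (h l))"
    if h: "polyf V h" for h k
  proof -
    obtain Q where Q: "\<And>k. coeff Q k \<in> carr V" "\<And>l. ev V l Q = h l"
      using h unfolding polyf_def by blast
    have "polyf V (\<lambda>l. act V p (h l))" for p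
      unfolding polyf_def using Q
      by (intro exI[of _ "map_poly (act V p) Q"]) (auto simp: coeff_map_poly ev_map_act)
    then show "polyf V (\<lambda>l. act V [:k:] (h l))" "polyf V (\<lambda>l. act V [:0, k:] (h l))" by auto
  qed
  have "evd V l (pCons c P) = c + (act V [:-1:] (act V [:l:] (evd V l P)) + act V [:0, -1:] (evd V l P))" for l
    by (simp add: evd_def psubst_pCons flip: scale_left_distrib)
  then show ?case
    by (simp only:) (intro polyf_add polyf_const c act_g polyf_shift g)
qed

subsection \<open>The conformal dual of a finite free module\<close>

lemma conf_module_triv: "conf_module triv_module"
  by (auto simp: conf_module_def triv_module_def module_def module.subspace_UNIV algebra_simps)

lemma carr_triv [simp]: "carr triv_module = UNIV"
  by (simp add: triv_module_def)

lemma act_triv [simp]: "act triv_module p c = poly p 0 * c"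
  by (simp add: triv_module_def)

lemma ev_triv [simp]: "ev triv_module l P = poly P l"
  by (simp add: ev_def psubst_def poly_altdef[of P] mult.commute)

section \<open>Polynomials in two variables, as polynomial families in the regular module\<close>

abbreviation poly_module :: "complex poly cmodule" where
  "poly_module \<equiv> \<lparr>carr = UNIV, act = (*)\<rparr>"

lemma conf_module_poly: "conf_module poly_module"
  by (auto simp: conf_module_def module_def module.subspace_UNIV algebra_simps)

lemma polyf_pcompose_const: "polyf poly_module (\<lambda>l. pcompose p [:s * l, t:])"
proof (induction p)
  interpret P: conf_mod poly_module by unfold_locales (rule conf_module_poly)
  case 0
  show ?case by auto
next
  interpret P: conf_mod poly_module by unfold_locales (rule conf_module_poly)
  case (pCons c p)
  have *: "polyf poly_module (\<lambda>l. q * g l)" if "polyf poly_module g" for q g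
    by (rule polyf_semilin[OF conf_module_poly conf_module_poly _ that, of "[:0, 1:]"])
      (simp add: semilin_def algebra_simps)
  have "pcompose (pCons c p) [:s * l, t:] =
      [:c:] + (([:s:] * ([:l:] * pcompose p [:s * l, t:])) + [:0, t:] * pcompose p [:s * l, t:])" for l
    by (simp add: pcompose_pCons algebra_simps)
  moreover have "polyf poly_module (\<lambda>l. [:c:] +
      (([:s:] * ([:l:] * pcompose p [:s * l, t:])) + [:0, t:] * pcompose p [:s * l, t:]))"
    using P.polyf_shift[OF pCons.IH]
    by (intro P.polyf_add P.polyf_const * pCons.IH) auto
  ultimately show ?case by simp
qed

text \<open>Replacing \<mu> by s\<lambda> + t\<mu> keeps a polynomial in \<lambda> and \<mu>. The
  later uses are \<mu>-\<lambda> for \<open>dual_op\<close>, \<mu>+\<lambda> for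
  \<open>codual_op\<close>, and -\<mu> for the twisted action on the dual.\<close>

lemma polyf_pcompose:
  assumes "polyf poly_module g"
  shows "polyf poly_module (\<lambda>l. pcompose (g l) [:s * l, t:])"
proof -
  interpret P: conf_mod poly_module by unfold_locales (rule conf_module_poly)
  obtain Q where Q: "\<And>l. ev poly_module l Q = g l"
    using assms unfolding polyf_def by blast
  have "polyf poly_module (\<lambda>l. pcompose (ev poly_module l Q) [:s * l, t:])"
  proof (induction Q)
    case 0
    show ?case by (auto simp: ev_def)
  next
    case (pCons c Q)
    have "polyf poly_module (\<lambda>l. pcompose c [:s * l, t:] +
        act poly_module [:l:] (pcompose (ev poly_module l Q) [:s * l, t:]))"
      by (intro P.polyf_add P.polyf_shift pCons.IH polyf_pcompose_const)
    then show ?case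
      by (simp add: P.ev_pCons pcompose_add pcompose_mult pcompose_smult)
  qed
  then show ?thesis by (simp add: Q)
qed

lemma polyf_act:
  assumes V: "conf_module V" and g: "polyf poly_module g" and v: "v \<in> carr V"
  shows "polyf V (\<lambda>l. act V (g l) v)"
proof (rule polyf_semilin[OF conf_module_poly V _ g, of "[:0, 1:]"])
  interpret V: conf_mod V by unfold_locales fact
  show "semilin poly_module V [:0, 1:] (\<lambda>q. act V q v)"
    using v by (simp add: semilin_def V.scale_left_distrib)
qed

text \<open>On the target \<partial> is zero, so the rule \<partial>+m is the number m. The
  multiplier is thus constant, which opens the way to \<open>psubst_point\<close>.\<close>

lemma cdual_iff:
  assumes A: "conf_module A"
  shows "f \<in> carr (cdual A) \<longleftrightarrow>
    (\<forall>m. semilin A triv_module [:m:] (\<lambda>a. poly (f a) m)) \<and> (\<forall>a. a \<notin> carr A \<longrightarrow> f a = 0)"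
proof -
  have "f \<in> Chom A triv_module \<longleftrightarrow> (\<forall>m. semilin A triv_module [:m:] (\<lambda>a. poly (f a) m))"
    using clinear_map_der_iff[OF A conf_module_triv, of f "\<lambda>l. [:l:]"]
    by (simp add: Chom_def der_def scl_def)
  then show ?thesis by (simp add: cdual_def)
qed

section \<open>Dual basis, biduality and transposed operators\<close>

locale dual_pair =
  fixes A :: "('a::ab_group_add, 'm) cmodule_scheme"
    and D :: "('a \<Rightarrow> complex poly, 'n) cmodule_scheme"
    and S :: "'a set"
  assumes A: "conf_module A" and D: "conf_module D"
    and carr_D: "carr D = carr (cdual A)" and act_D: "act D = act (cdual A)"
    and basis: "finite S" "S \<subseteq> carr A" "\<not> module.dependent (act A) S" "module.span (act A) S = carr A"
begin

sublocale A: conf_mod A by unfold_locales (rule A)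
sublocale D: conf_mod D by unfold_locales (rule D)

lemma ev_D: "ev (cdual A) = ev D"
  by (simp add: fun_eq_iff ev_def psubst_def act_D)

lemma act_D_apply: "act D p f x = pcompose p [:0, - 1:] * f x"
  by (simp add: act_D cdual_def)

lemma D_iff: "f \<in> carr D \<longleftrightarrow>
    (\<forall>m. semilin A triv_module [:m:] (\<lambda>a. poly (f a) m)) \<and> (\<forall>a. a \<notin> carr A \<longrightarrow> f a = 0)"
  unfolding carr_D by (rule cdual_iff[OF A])

lemma D_semilin: "f \<in> carr D \<Longrightarrow> semilin A triv_module [:m:] (\<lambda>a. poly (f a) m)"
  by (simp add: D_iff)

lemma D_outside: "f \<in> carr D \<Longrightarrow> x \<notin> carr A \<Longrightarrow> f x = 0"
  by (simp add: D_iff)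

lemma poly_ext: "(\<And>m. poly p m = poly q m) \<Longrightarrow> p = q" for p q :: "complex poly"
  by (simp add: poly_eq_poly_eq_iff[symmetric] fun_eq_iff)

lemma D_add: "f \<in> carr D \<Longrightarrow> x \<in> carr A \<Longrightarrow> y \<in> carr A \<Longrightarrow> f (x + y) = f x + f y"
  using semilin_add[OF D_semilin] by (intro poly_ext) simp

text \<open>With \<open>D_add\<close> and the converse \<open>DI\<close>, the conformal dual
  consists of the ordinary \<complex>[\<partial>]-linear maps from \<open>A\<close> to polynomials;
  only its own module structure is twisted by \<partial> \<mapsto> -\<partial>.\<close>

lemma D_act: "f \<in> carr D \<Longrightarrow> x \<in> carr A \<Longrightarrow> f (act A p x) = p * f x"
  using semilin_act[OF D_semilin] by (intro poly_ext) (simp add: poly_pcompose)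

lemma D_0: "f \<in> carr D \<Longrightarrow> f 0 = 0"
  using D_add[of f 0 0] by simp

lemma D_sum: "f \<in> carr D \<Longrightarrow> (\<And>i. i \<in> I \<Longrightarrow> x i \<in> carr A) \<Longrightarrow> f (sum x I) = (\<Sum>i\<in>I. f (x i))"
  by (induction I rule: infinite_finite_induct) (auto simp: D_0 D_add A.carr_sum)

lemma DI:
  assumes "\<And>x y. x \<in> carr A \<Longrightarrow> y \<in> carr A \<Longrightarrow> f (x + y) = f x + f y"
    and "\<And>p x. x \<in> carr A \<Longrightarrow> f (act A p x) = p * f x" and "\<And>x. x \<notin> carr A \<Longrightarrow> f x = 0"
  shows "f \<in> carr D"
  using assms by (auto simp: D_iff semilin_def poly_pcompose)

lemma D_eqI:
  assumes "f \<in> carr D" "g \<in> carr D"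
    and "\<And>x m. x \<in> carr A \<Longrightarrow> poly (f x) m = poly (g x) m"
  shows "f = g"
proof
  show "f x = g x" for x
    using assms by (cases "x \<in> carr A") (auto simp: D_outside intro: poly_ext)
qed

lemma point_semilin: "semilin D triv_module [:- m:] (\<lambda>f. poly (f x) m)"
  by (simp add: semilin_def act_D_apply poly_pcompose)

lemma psubst_A:
  "f \<in> carr D \<Longrightarrow> (\<And>k. coeff P k \<in> carr A) \<Longrightarrow>
    poly (f (psubst A q P)) m = poly (f (ev A (poly q m) P)) m"
  by (rule psubst_point[OF A conf_module_triv D_semilin])

lemma psubst_D:
  "(\<And>k. coeff P k \<in> carr D) \<Longrightarrow>
    poly (psubst D q P x) m = poly (ev D (poly q (- m)) P x) m"
  by (rule psubst_point[OF D conf_module_triv point_semilin])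

text \<open>At the value m, \<partial> counts as m on \<open>A\<close> and as -m on the dual, so
  -\<lambda>-\<partial> becomes -\<lambda>-m here but m-\<lambda> in \<open>evd_D\<close>.\<close>

lemma evd_A:
  "f \<in> carr D \<Longrightarrow> (\<And>k. coeff P k \<in> carr A) \<Longrightarrow>
    poly (f (evd A l P)) m = poly (f (ev A (- l - m) P)) m"
  unfolding evd_def by (subst psubst_A) auto

lemma evd_D:
  "(\<And>k. coeff P k \<in> carr D) \<Longrightarrow> poly (evd D l P x) m = poly (ev D (m - l) P x) m"
  unfolding evd_def by (subst psubst_D) auto

definition dual_basis :: "'a \<Rightarrow> 'a \<Rightarrow> complex poly" where
  "dual_basis e x = (if x \<in> carr A then A.representation S x e else 0)"

lemma dual_basis_in: "dual_basis e \<in> carr D"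
  using basis by (intro DI) (auto simp: dual_basis_def A.representation_add A.representation_scale)

lemma basis_in: "e \<in> S \<Longrightarrow> e \<in> carr A"
  using basis by auto

lemma basis_expand: "x \<in> carr A \<Longrightarrow> x = (\<Sum>e\<in>S. act A (dual_basis e x) e)"
  using basis by (simp add: dual_basis_def A.sum_representation_eq)

lemma D_expand: "h \<in> carr D \<Longrightarrow> x \<in> carr A \<Longrightarrow> h x = (\<Sum>e\<in>S. dual_basis e x * h e)"
  by (subst basis_expand) (auto simp: D_sum D_act basis_in)

lemma sum_fun_apply: "(\<Sum>i\<in>I. (f i :: 'x \<Rightarrow> 'y::ab_group_add)) x = (\<Sum>i\<in>I. f i x)"
  by (induction I rule: infinite_finite_induct) auto

text \<open>The coefficient at \<open>e\<close> is h(e) with its variable negated: acting by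
  p(\<partial>) on the dual multiplies by p(-\<lambda>), and the two signs cancel.\<close>

lemma dual_expand:
  assumes h: "h \<in> carr D"
  shows "h = (\<Sum>e\<in>S. act D (pcompose (h e) [:0, - 1:]) (dual_basis e))"
proof
  fix x
  have "pcompose (pcompose p [:0, - 1:]) [:0, - 1:] = p" for p :: "complex poly"
    by (simp flip: pcompose_assoc) (simp add: pcompose_pCons)
  then show "h x = (\<Sum>e\<in>S. act D (pcompose (h e) [:0, - 1:]) (dual_basis e)) x"
    using h by (cases "x \<in> carr A")
      (auto simp: sum_fun_apply act_D_apply D_expand[of h x] D_outside[of h x] dual_basis_def mult.commute)
qed

text \<open>Injectivity of the map from \<open>A\<close> to its bidual: already the coordinate
  functionals separate points.\<close>

lemma A_eqI:
  assumes "x \<in> carr A" "y \<in> carr A"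
    and "\<And>h m. h \<in> carr D \<Longrightarrow> poly (h x) m = poly (h y) m"
  shows "x = y"
proof -
  have "dual_basis e x = dual_basis e y" for e
    using assms(3) dual_basis_in by (intro poly_ext) auto
  then show ?thesis
    using basis_expand[OF assms(1)] basis_expand[OF assms(2)] by simp
qed

text \<open>By \<open>dual_expand\<close> the family is a combination of the fixed functionals
  \<open>dual_basis e\<close>, and there are finitely many of them, so only its values on
  \<open>S\<close> need to be polynomial.\<close>

lemma polyf_D:
  assumes g: "\<And>l. g l \<in> carr D" and "\<And>e. e \<in> S \<Longrightarrow> polyf poly_module (\<lambda>l. g l e)"
  shows "polyf D g"
proof -
  have "polyf D (\<lambda>l. \<Sum>e\<in>S. act D (pcompose (g l e) [:0, - 1:]) (dual_basis e))"
    using basis(1) assms(2) polyf_pcompose[of _ 0 "- 1"]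
    by (intro D.polyf_sum polyf_act[OF D _ dual_basis_in]) auto
  then show ?thesis
    using g by (simp flip: dual_expand)
qed

text \<open>The transpose of a conformal linear map \<open>T\<close> is polynomial in \<open>\<lambda>\<close> because it is determined by
  its values on the finite basis.\<close>

lemma dual_op_eval:
  assumes T: "\<And>l. semilin A A [:l, 1:] (T a l)" and pT: "\<And>b. b \<in> carr A \<Longrightarrow> polyf A (\<lambda>l. T a l b)"
    and f: "f \<in> carr D"
  shows "coeff (dual_op A T a f) k \<in> carr D"
    and "b \<in> carr A \<Longrightarrow> poly (ev D l (dual_op A T a f) b) m = poly (f (T a l b)) (m - l)"
proof -
  \<comment> \<open>The shift \<mu> \<mapsto> \<mu>-\<lambda> undoes the rule \<partial> \<mapsto>
    \<partial>+\<lambda> of \<open>T a l\<close>; this is why \<open>g l\<close> is again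
    \<complex>[\<partial>]-linear and lies in the dual.\<close>
  define g where "g l = (\<lambda>b. if b \<in> carr A then pcompose (f (T a l b)) [:- l, 1:] else 0)" for l
  have Tc: "b \<in> carr A \<Longrightarrow> T a l b \<in> carr A" for l b by (rule semilin_closed[OF T])
  have shift: "pcompose (pcompose p [:l, 1:]) [:- l, 1:] = p" for p :: "complex poly" and l
    by (simp flip: pcompose_assoc) (simp add: pcompose_pCons)
  have gD: "g l \<in> carr D" for l
    using f by (intro DI)
      (auto simp: g_def semilin_add[OF T] semilin_act[OF T] Tc D_add D_act pcompose_add pcompose_mult shift)
  have "polyf poly_module (\<lambda>l. g l e)" if e: "e \<in> S" for e
  proof -
    have "polyf poly_module (\<lambda>l. f (T a l e))"
      using f by (intro polyf_semilin[OF A conf_module_poly _ pT[OF basis_in[OF e]], of "[:0, 1:]"])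
        (auto simp: semilin_def D_add D_act)
    from polyf_pcompose[OF this, of "- 1" 1] show ?thesis
      by (simp add: g_def basis_in e)
  qed
  then have "polyf D g" by (intro polyf_D gD)
  from D.ex1_polyf[OF this]
  have ex1: "\<exists>!P. (\<forall>k. coeff P k \<in> carr D) \<and> (\<forall>l. ev D l P = g l)" .
  have "ev D l P = g l \<longleftrightarrow> (\<forall>m. \<forall>b\<in>carr A. poly (ev D l P b) m = poly (f (T a l b)) (m - l))"
    if "\<forall>k. coeff P k \<in> carr D" for l P
    using gD D.ev_closed[of P l] that
    by (auto simp: g_def poly_pcompose intro!: D_eqI)
  then have "dual_op A T a f = (THE P. (\<forall>k. coeff P k \<in> carr D) \<and> (\<forall>l. ev D l P = g l))"
    unfolding dual_op_def ev_D carr_D[symmetric] by (intro arg_cong[where f = The] ext) blast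
  with theI'[OF ex1] have *: "\<forall>k. coeff (dual_op A T a f) k \<in> carr D" "\<forall>l. ev D l (dual_op A T a f) = g l"
    by auto
  show "coeff (dual_op A T a f) k \<in> carr D" using * by blast
  show "poly (ev D l (dual_op A T a f) b) m = poly (f (T a l b)) (m - l)" if "b \<in> carr A"
    using * that by (simp add: g_def poly_pcompose)
qed

text \<open>An element of \<open>A\<close> is known through its coordinates, and these are
  prescribed on the functionals \<open>dual_basis e\<close>. The formula for a general
  \<open>h\<close> follows by expanding \<open>h\<close> and using semilinearity of
  \<open>T f l\<close>. The variable m here is -\<mu> in \<open>codual_op\<close>.\<close>

lemma codual_op_eval:
  assumes T: "\<And>l. semilin D D [:l, 1:] (T f l)" and pT: "\<And>h. h \<in> carr D \<Longrightarrow> polyf D (\<lambda>l. T f l h)"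
    and a: "a \<in> carr A"
  shows "coeff (codual_op A D T f a) k \<in> carr A"
    and "h \<in> carr D \<Longrightarrow> poly (h (ev A l (codual_op A D T f a))) m = poly (T f l h a) (l + m)"
proof -
  \<comment> \<open>The coordinate at \<open>e\<close> forced by taking h =
    \<open>dual_basis e\<close> in the required identity.\<close>
  define q where "q e l = pcompose (T f l (dual_basis e) a) [:l, 1:]" for e l
  define g where "g l = (\<Sum>e\<in>S. act A (q e l) e)" for l
  have gA: "g l \<in> carr A" for l
    unfolding g_def by (intro A.carr_sum) (auto simp: basis_in)
  have g: "poly (h (g l)) m = poly (T f l h a) (l + m)" if h: "h \<in> carr D" for h l m
  proof -
    have T0: "T f l 0 = 0" using semilin_add[OF T, of 0 0 l] by simp
    have T_sum: "T f l (sum x I) = (\<Sum>i\<in>I. T f l (x i))" if "\<And>i. i \<in> I \<Longrightarrow> x i \<in> carr D" for x and I :: "'a set"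
      using that by (induction I rule: infinite_finite_induct) (auto simp: T0 semilin_add[OF T] D.carr_sum)
    have "T f l h a = (\<Sum>e\<in>S. act D (pcompose (pcompose (h e) [:0, - 1:]) [:l, 1:]) (T f l (dual_basis e))) a"
      using h by (subst dual_expand) (auto simp: T_sum semilin_act[OF T] dual_basis_in)
    then show ?thesis
      using h by (simp add: g_def D_sum D_act basis_in sum_fun_apply act_D_apply poly_sum poly_pcompose
          q_def mult.commute)
  qed
  have "polyf poly_module (\<lambda>l. q e l)" for e
  proof -
    have "polyf poly_module (\<lambda>l. T f l (dual_basis e) a)"
      by (intro polyf_semilin[OF D conf_module_poly _ pT[OF dual_basis_in], of "[:0, - 1:]"])
        (auto simp: semilin_def act_D_apply)
    from polyf_pcompose[OF this, of 1 1] show ?thesis by (simp add: q_def)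
  qed
  then have "polyf A g"
    unfolding g_def using basis(1) by (intro A.polyf_sum polyf_act[OF A]) (auto simp: basis_in)
  from A.ex1_polyf[OF this]
  have ex1: "\<exists>!P. (\<forall>k. coeff P k \<in> carr A) \<and> (\<forall>l. ev A l P = g l)" .
  have "ev A l P = g l \<longleftrightarrow> (\<forall>m. \<forall>h\<in>carr D. poly (h (ev A l P)) (- m) = poly (T f l h a) (l - m))"
    if "\<forall>k. coeff P k \<in> carr A" for l P
  proof
    assume *: "\<forall>m. \<forall>h\<in>carr D. poly (h (ev A l P)) (- m) = poly (T f l h a) (l - m)"
    have "poly (h (ev A l P)) m = poly (h (g l)) m" if "h \<in> carr D" for h m
      using *[rule_format, OF that, of "- m"] g[OF that, of l m] by simp
    then show "ev A l P = g l"
      using gA A.ev_closed[of P l] \<open>\<forall>k. coeff P k \<in> carr A\<close> by (intro A_eqI) auto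
  qed (simp add: g)
  then have "codual_op A D T f a = (THE P. (\<forall>k. coeff P k \<in> carr A) \<and> (\<forall>l. ev A l P = g l))"
    unfolding codual_op_def by (intro arg_cong[where f = The] ext) blast
  with theI'[OF ex1] have *: "\<forall>k. coeff (codual_op A D T f a) k \<in> carr A"
    "\<forall>l. ev A l (codual_op A D T f a) = g l"
    by auto
  show "coeff (codual_op A D T f a) k \<in> carr A" using * by blast
  show "poly (h (ev A l (codual_op A D T f a))) m = poly (T f l h a) (l + m)" if "h \<in> carr D"
    using * g that by simp
qed

end

subsection \<open>Associativity on a direct sum\<close>

text \<open>Splitting into homogeneous triples uses sums only, so additivity relative to the
  carriers is all that is recorded.\<close>

definition biadditive ::
  "'u::ab_group_add set \<Rightarrow> 'v::ab_group_add set \<Rightarrow> 'w::ab_group_add set \<Rightarrow> ('u \<Rightarrow> 'v \<Rightarrow> 'w) \<Rightarrow> bool" where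
  "biadditive X Y Z f \<longleftrightarrow> (\<forall>x\<in>X. \<forall>y\<in>Y. f x y \<in> Z) \<and>
     (\<forall>x\<in>X. \<forall>x'\<in>X. \<forall>y\<in>Y. f (x + x') y = f x y + f x' y) \<and>
     (\<forall>x\<in>X. \<forall>y\<in>Y. \<forall>y'\<in>Y. f x (y + y') = f x y + f x y')"

lemma biadditive_D:
  assumes "biadditive X Y Z f"
  shows "x \<in> X \<Longrightarrow> y \<in> Y \<Longrightarrow> f x y \<in> Z"
    and "x \<in> X \<Longrightarrow> x' \<in> X \<Longrightarrow> y \<in> Y \<Longrightarrow> f (x + x') y = f x y + f x' y"
    and "x \<in> X \<Longrightarrow> y \<in> Y \<Longrightarrow> y' \<in> Y \<Longrightarrow> f x (y + y') = f x y + f x y'"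
    and "0 \<in> X \<Longrightarrow> y \<in> Y \<Longrightarrow> f 0 y = 0"
    and "x \<in> X \<Longrightarrow> 0 \<in> Y \<Longrightarrow> f x 0 = 0"
proof -
  show "f 0 y = 0" if "0 \<in> X" "y \<in> Y"
  proof -
    have "f (0 + 0) y = f 0 y + f 0 y" using assms that unfolding biadditive_def by blast
    then show ?thesis by simp
  qed
  show "f x 0 = 0" if "x \<in> X" "0 \<in> Y"
  proof -
    have "f x (0 + 0) = f x 0 + f x 0" using assms that unfolding biadditive_def by blast
    then show ?thesis by simp
  qed
qed (use assms in \<open>auto simp: biadditive_def\<close>)

text \<open>The conformal structure is abstracted away: \<open>RA\<close> and \<open>RB\<close>
  stand for right actions at -\<lambda>-\<partial>, with arguments in the order of the product.
  Triples inside one summand are covered by the two given associative laws. The six mixed types have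
  two components each, which gives the six bimodule axioms and the six matching conditions.\<close>

lemma product_assoc_iff:
  fixes mA :: "complex \<Rightarrow> 'a::ab_group_add \<Rightarrow> 'a \<Rightarrow> 'a"
    and mB :: "complex \<Rightarrow> 'b::ab_group_add \<Rightarrow> 'b \<Rightarrow> 'b"
  assumes zero: "0 \<in> X" "0 \<in> Y"
    and add: "\<And>a b. a \<in> X \<Longrightarrow> b \<in> X \<Longrightarrow> a + b \<in> X" "\<And>x y. x \<in> Y \<Longrightarrow> y \<in> Y \<Longrightarrow> x + y \<in> Y"
    and mA: "\<And>l. biadditive X X X (mA l)" and LB: "\<And>l. biadditive Y X X (LB l)"
    and RB: "\<And>l. biadditive X Y X (RB l)"
    and mB: "\<And>l. biadditive Y Y Y (mB l)" and LA: "\<And>l. biadditive X Y Y (LA l)"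
    and RA: "\<And>l. biadditive Y X Y (RA l)"
    and assocA: "\<And>l m a b c. a \<in> X \<Longrightarrow> b \<in> X \<Longrightarrow> c \<in> X \<Longrightarrow>
      mA (l + m) (mA l a b) c = mA l a (mA m b c)"
    and assocB: "\<And>l m x y z. x \<in> Y \<Longrightarrow> y \<in> Y \<Longrightarrow> z \<in> Y \<Longrightarrow>
      mB (l + m) (mB l x y) z = mB l x (mB m y z)"
    and mE: "\<And>l a b x y. a \<in> X \<Longrightarrow> b \<in> X \<Longrightarrow> x \<in> Y \<Longrightarrow> y \<in> Y \<Longrightarrow> mE l (a, x) (b, y) =
      (mA l a b + LB l x b + RB l a y, mB l x y + LA l a y + RA l x b)"
  shows "(\<forall>l m. \<forall>u\<in>X \<times> Y. \<forall>v\<in>X \<times> Y. \<forall>w\<in>X \<times> Y.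
        mE (l + m) (mE l u v) w = mE l u (mE m v w)) \<longleftrightarrow>
    (\<forall>l m. \<forall>a\<in>X. \<forall>b\<in>X. \<forall>y\<in>Y.
        LA (l + m) (mA l a b) y = LA l a (LA m b y) \<and>
        RA (l + m) (RA l y a) b = RA l y (mA m a b) \<and>
        LA l a (RA m y b) = RA (l + m) (LA l a y) b) \<and>
    (\<forall>l m. \<forall>x\<in>Y. \<forall>y\<in>Y. \<forall>a\<in>X.
        LB (l + m) (mB l x y) a = LB l x (LB m y a) \<and>
        RB (l + m) (RB l a x) y = RB l a (mB m x y) \<and>
        LB l x (RB m a y) = RB (l + m) (LB l x a) y) \<and>
    (\<forall>l m. \<forall>a\<in>X. \<forall>b\<in>X. \<forall>x\<in>Y. \<forall>y\<in>Y.
        LA l a (mB m x y) = mB (l + m) (LA l a x) y + LA (l + m) (RB l a x) y \<and>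
        RB (l + m) (mA l a b) x = mA l a (RB m b x) + RB l a (LA m b x) \<and>
        LB l x (mA m a b) = mA (l + m) (LB l x a) b + LB (l + m) (RA l x a) b \<and>
        RA l x (LB m y a) + mB l x (RA m y a) = RA (l + m) (mB l x y) a \<and>
        RA l x (RB m a y) + mB l x (LA m a y) =
          LA (l + m) (LB l x a) y + mB (l + m) (RA l x a) y \<and>
        mA l a (LB m x b) + RB l a (RA m x b) =
          mA (l + m) (RB l a x) b + LB (l + m) (LA l a x) b)" (is "?assoc \<longleftrightarrow> ?R")
proof -
  note ops = biadditive_D[OF mA] biadditive_D[OF LB] biadditive_D[OF RB]
    biadditive_D[OF mB] biadditive_D[OF LA] biadditive_D[OF RA]
  let ?T = "\<lambda>l m u v w. mE (l + m) (mE l u v) w = mE l u (mE m v w)"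
  have mm: "biadditive (X \<times> Y) (X \<times> Y) (X \<times> Y) (mE l)" for l
    unfolding biadditive_def using add by (auto simp: mE ops ac_simps)
  note mms = biadditive_D[OF mm]
  have split: "?assoc \<longleftrightarrow> (\<forall>l m. \<forall>a\<in>X. \<forall>b\<in>X. \<forall>c\<in>X. \<forall>x\<in>Y. \<forall>y\<in>Y. \<forall>z\<in>Y.
      ?T l m (a, 0) (b, 0) (0, z) \<and> ?T l m (a, 0) (0, y) (c, 0) \<and> ?T l m (0, x) (b, 0) (c, 0) \<and>
      ?T l m (a, 0) (0, y) (0, z) \<and> ?T l m (0, x) (b, 0) (0, z) \<and> ?T l m (0, x) (0, y) (c, 0))"
    (is "_ \<longleftrightarrow> ?S")
  proof
    assume ?assoc
    then show ?S using zero by auto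
  next
    assume S: ?S
    show ?assoc
    proof (intro allI ballI)
      fix l m u v w
      assume uvw: "u \<in> X \<times> Y" "v \<in> X \<times> Y" "w \<in> X \<times> Y"
      obtain a x b y c z where eq: "u = (a, x)" "v = (b, y)" "w = (c, z)"
        by (cases u, cases v, cases w)
      have "?T l m (a, 0) (b, 0) (c, 0)" "?T l m (0, x) (0, y) (0, z)"
        using uvw eq zero by (auto simp: mE ops assocA assocB)
      then have T: "?T l m u' v' w'" if "u' \<in> {(a, 0), (0, x)}" "v' \<in> {(b, 0), (0, y)}" "w' \<in> {(c, 0), (0, z)}"
        for u' v' w'
        using that S uvw eq by auto
      have in': "(a, 0) \<in> X \<times> Y" "(0, x) \<in> X \<times> Y" "(b, 0) \<in> X \<times> Y" "(0, y) \<in> X \<times> Y"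
        "(c, 0) \<in> X \<times> Y" "(0, z) \<in> X \<times> Y"
        using uvw eq zero by auto
      have "u = (a, 0) + (0, x)" "v = (b, 0) + (0, y)" "w = (c, 0) + (0, z)"
        using eq by auto
      \<comment> \<open>Closure lets additivity be applied to the nested products, which then break
        into sums over the eight homogeneous triples.\<close>
      moreover have "p + q \<in> X \<times> Y" if "p \<in> X \<times> Y" "q \<in> X \<times> Y" for p q
        using that add by auto
      ultimately show "?T l m u v w"
        using in' by (simp only: mms T insert_iff simp_thms add.assoc add.left_commute add.commute)
    qed
  qed
  show ?thesis unfolding split
    using zero by (auto simp: mE ops ac_simps)
qed

subsection \<open>The bicrossed product\<close>

lemma Cend_hom_formD:
  assumes "Cend_hom_form A M \<rho>"
  shows "a \<in> carr A \<Longrightarrow> v \<in> carr M \<Longrightarrow> coeff (\<rho> a v) k \<in> carr M"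
    and "a \<in> carr A \<Longrightarrow> semilin M M [:l, 1:] (\<lambda>v. ev M l (\<rho> a v))"
    and "v \<in> carr M \<Longrightarrow> semilin A M [:- l:] (\<lambda>a. ev M l (\<rho> a v))"
  using assms by (auto simp: Cend_hom_form_def)

text \<open>With -\<lambda>-\<partial> inserted, the two rules change places. A right action thus
  obeys the rules of a product in which the acting element is the right factor.\<close>

lemma Cend_hom_form_evd:
  assumes A: "conf_module A" and M: "conf_module M" and \<rho>: "Cend_hom_form A M \<rho>"
  shows "a \<in> carr A \<Longrightarrow> semilin M M [:- l:] (\<lambda>v. evd M l (\<rho> a v))"
    and "v \<in> carr M \<Longrightarrow> semilin A M [:l, 1:] (\<lambda>a. evd M l (\<rho> a v))"
  using semilin_evd[OF M M, of "\<rho> a" 1 1 l] semilin_evd[OF A M, of "\<lambda>a. \<rho> a v" "- 1" 0 l]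
    Cend_hom_formD[OF \<rho>] by simp_all

lemma conf_module_direct_sum:
  assumes "conf_module A" "conf_module B"
  shows "conf_module (direct_sum A B)"
proof -
  interpret A: conf_mod A by unfold_locales fact
  interpret B: conf_mod B by unfold_locales fact
  have "module (act (direct_sum A B))"
    by (auto simp: module_def direct_sum_def A.scale_right_distrib B.scale_right_distrib
        A.scale_left_distrib B.scale_left_distrib split: prod.splits)
  then show ?thesis
    by (auto simp: conf_module_def module.subspace_def) (auto simp: direct_sum_def zero_prod_def)
qed

lemma underlying_eqD:
  assumes "underlying E = V"
  shows "carr E = carr V" "act E = act V"
  using arg_cong[OF assms, of carr] arg_cong[OF assms, of act] by (simp_all add: cmodule.truncate_def)

lemma conf_module_cong: "carr E = carr V \<Longrightarrow> act E = act V \<Longrightarrow> conf_module E \<longleftrightarrow> conf_module V"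
  by (simp add: conf_module_def)

lemma ev_cong: "act E = act V \<Longrightarrow> ev E l P = ev V l P"
  by (simp add: ev_def psubst_def)

text \<open>Only the sesquilinearity shared by both sides of the equivalence is assumed here; the
  bimodule axioms belong to what associativity will express.\<close>

locale algebra_pair =
  fixes A :: "('a::ab_group_add, 'm) calgebra_scheme"
    and B :: "('b::ab_group_add, 'n) calgebra_scheme"
    and lA rA :: "'a \<Rightarrow> 'b \<Rightarrow> 'b poly" and lB rB :: "'b \<Rightarrow> 'a \<Rightarrow> 'a poly"
  assumes A: "conf_algebra A" and B: "conf_algebra B"
    and lA: "Cend_hom A B lA" and rA: "Cend_hom A B rA"
    and lB: "Cend_hom B A lB" and rB: "Cend_hom B A rB"
begin

sublocale A: conf_mod A using A by unfold_locales (simp add: conf_algebra_def)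
sublocale B: conf_mod B using B by unfold_locales (simp add: conf_algebra_def)

definition bicrossed :: "complex \<Rightarrow> 'a \<times> 'b \<Rightarrow> 'a \<times> 'b \<Rightarrow> 'a \<times> 'b" where
  "bicrossed l = (\<lambda>(a, x) (b, y).
     (ev A l (lprod A a b) + ev A l (lB x b) + evd A l (rB y a),
      ev B l (lprod B x y) + ev B l (lA a y) + evd B l (rA b x)))"

lemma forms:
  "Cend_hom_form A A (lprod A)" "Cend_hom_form B B (lprod B)"
  "Cend_hom_form A B lA" "Cend_hom_form A B rA" "Cend_hom_form B A lB" "Cend_hom_form B A rB"
  using A B lA rA lB rB
  by (auto simp: conf_algebra_iff Cend_hom_iff A.conf_module B.conf_module)

lemmas coeff_closed = forms[THEN Cend_hom_formD(1)]

text \<open>Sorted by position in the product: these six describe dependence on the right factor,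
  where \<partial> becomes \<partial>+\<lambda>, and \<open>right_semilin\<close> describes
  dependence on the left factor, where it becomes -\<lambda>. For \<open>rA\<close> and
  \<open>rB\<close> the order of arguments is the opposite one.\<close>

lemmas left_semilin = Cend_hom_formD(2)[OF forms(1)] Cend_hom_formD(2)[OF forms(2)]
  Cend_hom_formD(2)[OF forms(3)] Cend_hom_formD(2)[OF forms(5)]
  Cend_hom_form_evd(2)[OF A.conf_module B.conf_module forms(4)]
  Cend_hom_form_evd(2)[OF B.conf_module A.conf_module forms(6)]

lemmas right_semilin = Cend_hom_formD(3)[OF forms(1)] Cend_hom_formD(3)[OF forms(2)]
  Cend_hom_formD(3)[OF forms(3)] Cend_hom_formD(3)[OF forms(5)]
  Cend_hom_form_evd(1)[OF A.conf_module B.conf_module forms(4)]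
  Cend_hom_form_evd(1)[OF B.conf_module A.conf_module forms(6)]

lemma bicrossed_polyf:
  assumes u: "u \<in> carr (direct_sum A B)" and v: "v \<in> carr (direct_sum A B)"
  shows "polyf (direct_sum A B) (\<lambda>l. bicrossed l u v)"
proof -
  let ?E = "direct_sum A B"
  have E: "conf_module ?E" by (intro conf_module_direct_sum A.conf_module B.conf_module)
  interpret E: conf_mod ?E by unfold_locales (rule E)
  obtain a x b y where uv: "u = (a, x)" "v = (b, y)" by (cases u, cases v)
  then have in': "a \<in> carr A" "b \<in> carr A" "x \<in> carr B" "y \<in> carr B"
    using u v by (auto simp: direct_sum_def)
  have i1: "semilin A ?E [:0, 1:] (\<lambda>c. (c, 0))" and i2: "semilin B ?E [:0, 1:] (\<lambda>z. (0, z))"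
    by (auto simp: semilin_def direct_sum_def)
  have "polyf A (\<lambda>l. ev A l (lprod A a b) + ev A l (lB x b) + evd A l (rB y a))"
    by (intro A.polyf_add A.polyf_ev A.polyf_evd coeff_closed in')
  moreover have "polyf B (\<lambda>l. ev B l (lprod B x y) + ev B l (lA a y) + evd B l (rA b x))"
    by (intro B.polyf_add B.polyf_ev B.polyf_evd coeff_closed in')
  ultimately have "polyf ?E (\<lambda>l.
      (ev A l (lprod A a b) + ev A l (lB x b) + evd A l (rB y a), 0) +
      (0, ev B l (lprod B x y) + ev B l (lA a y) + evd B l (rA b x)))"
    by (intro E.polyf_add polyf_semilin[OF A.conf_module E i1] polyf_semilin[OF B.conf_module E i2])
  then show ?thesis by (simp add: bicrossed_def uv)
qed

lemma bicrossed_semilin: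
  assumes E: "carr E = carr (direct_sum A B)" "act E = act (direct_sum A B)" and u: "u \<in> carr E"
  shows "semilin E E [:l, 1:] (\<lambda>v. bicrossed l u v)"
    and "semilin E E [:- l:] (\<lambda>v. bicrossed l v u)"
proof -
  obtain a x where u': "u = (a, x)" "a \<in> carr A" "x \<in> carr B"
    using u E by (auto simp: direct_sum_def)
  show "semilin E E [:l, 1:] (\<lambda>v. bicrossed l u v)"
    unfolding semilin_def
    using u' left_semilin[THEN semilin_closed] left_semilin[THEN semilin_add] left_semilin[THEN semilin_act]
      right_semilin[THEN semilin_closed]
    by (auto simp: E direct_sum_def bicrossed_def A.scale_right_distrib B.scale_right_distrib)
  show "semilin E E [:- l:] (\<lambda>v. bicrossed l v u)"
    unfolding semilin_def
    using u' right_semilin[THEN semilin_closed] right_semilin[THEN semilin_add]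
      right_semilin[THEN semilin_act] left_semilin[THEN semilin_closed]
    by (auto simp: E direct_sum_def bicrossed_def A.scale_right_distrib B.scale_right_distrib)
qed

lemma ops_biadditive:
  "biadditive (carr A) (carr A) (carr A) (\<lambda>a b. ev A l (lprod A a b))"
  "biadditive (carr B) (carr A) (carr A) (\<lambda>x b. ev A l (lB x b))"
  "biadditive (carr A) (carr B) (carr A) (\<lambda>a y. evd A l (rB y a))"
  "biadditive (carr B) (carr B) (carr B) (\<lambda>x y. ev B l (lprod B x y))"
  "biadditive (carr A) (carr B) (carr B) (\<lambda>a y. ev B l (lA a y))"
  "biadditive (carr B) (carr A) (carr B) (\<lambda>x b. evd B l (rA b x))"
  using left_semilin[THEN semilin_closed] left_semilin[THEN semilin_add] right_semilin[THEN semilin_add]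
  by (simp_all add: biadditive_def)

text \<open>Stated for any \<open>E\<close> whose product has the bicrossed values, because it
  serves both a double construction that is given and one that is built.\<close>

lemma conf_algebra_iff_matched_pair:
  fixes E :: "('a \<times> 'b, 'k) calgebra_scheme"
  assumes E: "carr E = carr (direct_sum A B)" "act E = act (direct_sum A B)"
    and coeffs: "\<And>u v k. u \<in> carr E \<Longrightarrow> v \<in> carr E \<Longrightarrow> coeff (lprod E u v) k \<in> carr E"
    and prod: "\<And>u v l. u \<in> carr E \<Longrightarrow> v \<in> carr E \<Longrightarrow> ev E l (lprod E u v) = bicrossed l u v"
  shows "conf_algebra E \<longleftrightarrow> matched_pair A B lA rA lB rB"
proof -
  have mE: "conf_module E"
    using conf_module_direct_sum[OF A.conf_module B.conf_module] conf_module_cong[OF E] by simp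
  have carr_E: "carr E = carr A \<times> carr B" by (simp add: E direct_sum_def)
  have "Cend_hom E E (lprod E)"
    unfolding Cend_hom_iff[OF mE mE] Cend_hom_form_def
    by (intro conjI allI ballI coeffs semilin_cong[OF bicrossed_semilin(1)[OF E] prod mE]
        semilin_cong[OF bicrossed_semilin(2)[OF E] prod mE])
  then have "conf_algebra E \<longleftrightarrow> (\<forall>l m. \<forall>u\<in>carr E. \<forall>v\<in>carr E. \<forall>w\<in>carr E.
      bicrossed (l + m) (bicrossed l u v) w = bicrossed l u (bicrossed m v w))"
    unfolding conf_algebra_iff using mE prod bicrossed_semilin[OF E, THEN semilin_closed] by auto
  also have "\<dots> \<longleftrightarrow> matched_pair A B lA rA lB rB"
  proof -
    note iff = product_assoc_iff[OF A.carr_closed(1) B.carr_closed(1) A.carr_closed(2) B.carr_closed(2)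
        ops_biadditive, where mE = bicrossed]
    show ?thesis
      unfolding carr_E matched_pair_def bimodule_def
      using A B A.conf_module B.conf_module lA rA lB rB
      by (subst iff) (auto simp: conf_algebra_iff bicrossed_def)
  qed
  finally show ?thesis .
qed

end

subsection \<open>The dual operators\<close>

lemma conf_algebra_form: "conf_algebra A \<Longrightarrow> Cend_hom_form A A (lprod A)"
  using conf_algebra_iff[of A] Cend_hom_iff[of A A] by blast

lemma Lmul_semilin:
  assumes A: "conf_algebra A" and a: "a \<in> carr A"
  shows "semilin A A [:l, 1:] (Lmul A a l)" "b \<in> carr A \<Longrightarrow> polyf A (\<lambda>l. Lmul A a l b)"
proof -
  interpret conf_mod A using A by unfold_locales (simp add: conf_algebra_def)
  show "semilin A A [:l, 1:] (Lmul A a l)"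
    unfolding Lmul_def[abs_def] by (rule Cend_hom_formD[OF conf_algebra_form[OF A] a])
  show "polyf A (\<lambda>l. Lmul A a l b)" if "b \<in> carr A"
    unfolding Lmul_def by (intro polyf_ev Cend_hom_formD[OF conf_algebra_form[OF A]] a that)
qed

lemma Rmul_semilin:
  assumes A: "conf_algebra A" and a: "a \<in> carr A"
  shows "semilin A A [:l, 1:] (Rmul A a l)" "b \<in> carr A \<Longrightarrow> polyf A (\<lambda>l. Rmul A a l b)"
proof -
  interpret conf_mod A using A by unfold_locales (simp add: conf_algebra_def)
  show "semilin A A [:l, 1:] (Rmul A a l)"
    unfolding Rmul_def[abs_def]
    by (rule Cend_hom_form_evd[OF conf_module conf_module conf_algebra_form[OF A] a])
  show "polyf A (\<lambda>l. Rmul A a l b)" if "b \<in> carr A"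
    unfolding Rmul_def by (intro polyf_evd Cend_hom_formD[OF conf_algebra_form[OF A]] a that)
qed

locale dual_algebras =
  fixes A :: "('a::ab_group_add, 'm) calgebra_scheme"
    and D :: "('a \<Rightarrow> complex poly, 'n) calgebra_scheme"
    and S :: "'a set"
  assumes alg_A: "conf_algebra A" and alg_D: "conf_algebra D"
    and D_dual: "underlying D = cdual A"
    and S: "finite S" "S \<subseteq> carr A" "\<not> module.dependent (act A) S" "module.span (act A) S = carr A"
begin

sublocale dual_pair A D S
  using alg_A alg_D underlying_eqD[OF D_dual] S
  by unfold_locales (auto simp: conf_algebra_def)

abbreviation "lA \<equiv> dual_op A (Rmul A)"
abbreviation "rA \<equiv> dual_op A (Lmul A)"
abbreviation "lB \<equiv> codual_op A D (Rmul D)"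
abbreviation "rB \<equiv> codual_op A D (Lmul D)"

lemmas form_A = Cend_hom_formD[OF conf_algebra_form[OF alg_A]]
lemmas form_D = Cend_hom_formD[OF conf_algebra_form[OF alg_D]]

text \<open>The functional is taken at m-\<lambda>, where \<partial> is m-\<lambda>, so the
  subscript -\<lambda>-\<partial> of right multiplication becomes -m. In \<open>lB\<close> the value
  is at \<lambda>+m on the dual, and the subscript becomes m.\<close>

lemma lA:
  assumes "a \<in> carr A" "f \<in> carr D"
  shows "coeff (lA a f) k \<in> carr D"
    and "b \<in> carr A \<Longrightarrow> poly (ev D l (lA a f) b) m = poly (f (ev A (- m) (lprod A b a))) (m - l)"
  using dual_op_eval[of "Rmul A" a f] Rmul_semilin[OF alg_A] assms
  by (auto simp: Rmul_def evd_A form_A)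

lemma rA:
  assumes "a \<in> carr A" "f \<in> carr D"
  shows "coeff (rA a f) k \<in> carr D"
    and "b \<in> carr A \<Longrightarrow> poly (ev D l (rA a f) b) m = poly (f (ev A l (lprod A a b))) (m - l)"
  using dual_op_eval[of "Lmul A" a f] Lmul_semilin[OF alg_A] assms
  by (auto simp: Lmul_def)

lemma lB:
  assumes "f \<in> carr D" "a \<in> carr A"
  shows "coeff (lB f a) k \<in> carr A"
    and "h \<in> carr D \<Longrightarrow> poly (h (ev A l (lB f a))) m = poly (ev D m (lprod D h f) a) (l + m)"
  using codual_op_eval[of "Rmul D" f a] Rmul_semilin[OF alg_D] assms
  by (auto simp: Rmul_def evd_D form_D)

lemma rB:
  assumes "f \<in> carr D" "a \<in> carr A"
  shows "coeff (rB f a) k \<in> carr A"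
    and "h \<in> carr D \<Longrightarrow> poly (h (ev A l (rB f a))) m = poly (ev D l (lprod D f h) a) (l + m)"
  using codual_op_eval[of "Lmul D" f a] Lmul_semilin[OF alg_D] assms
  by (auto simp: Lmul_def)

lemma ev_in:
  "a \<in> carr A \<Longrightarrow> b \<in> carr A \<Longrightarrow> ev A l (lprod A a b) \<in> carr A"
  "f \<in> carr D \<Longrightarrow> g \<in> carr D \<Longrightarrow> ev D l (lprod D f g) \<in> carr D"
  "a \<in> carr A \<Longrightarrow> f \<in> carr D \<Longrightarrow> ev D l (lA a f) \<in> carr D"
  "a \<in> carr A \<Longrightarrow> f \<in> carr D \<Longrightarrow> ev D l (rA a f) \<in> carr D"
  "f \<in> carr D \<Longrightarrow> a \<in> carr A \<Longrightarrow> ev A l (lB f a) \<in> carr A"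
  "f \<in> carr D \<Longrightarrow> a \<in> carr A \<Longrightarrow> ev A l (rB f a) \<in> carr A"
  "a \<in> carr A \<Longrightarrow> f \<in> carr D \<Longrightarrow> evd D l (rA a f) \<in> carr D"
  "f \<in> carr D \<Longrightarrow> a \<in> carr A \<Longrightarrow> evd A l (rB f a) \<in> carr A"
  by (auto intro!: A.ev_closed D.ev_closed A.evd_closed D.evd_closed form_A form_D lA rA lB rB)

lemma evd_rA:
  "a \<in> carr A \<Longrightarrow> f \<in> carr D \<Longrightarrow> b \<in> carr A \<Longrightarrow>
    poly (evd D l (rA a f) b) m = poly (f (ev A (m - l) (lprod A a b))) l"
  by (simp add: evd_D rA)

lemma evd_rB:
  "f \<in> carr D \<Longrightarrow> a \<in> carr A \<Longrightarrow> h \<in> carr D \<Longrightarrow>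
    poly (h (evd A l (rB f a))) m = poly (ev D (- l - m) (lprod D f h) a) (- l)"
  by (simp add: evd_A rB)

lemmas prod_add_act =
  form_A(2)[THEN semilin_add] form_A(3)[THEN semilin_add]
  form_A(2)[THEN semilin_act] form_A(3)[THEN semilin_act]
  form_D(2)[THEN semilin_add] form_D(3)[THEN semilin_add]
  form_D(2)[THEN semilin_act] form_D(3)[THEN semilin_act]

text \<open>Paired with the elements that separate points, each rule reduces to additivity and
  sesquilinearity of the products of \<open>A\<close> and \<open>D\<close> at scalars.\<close>

lemma Cend_hom_ops: "Cend_hom A D lA" "Cend_hom A D rA" "Cend_hom D A lB" "Cend_hom D A rB"
  unfolding Cend_hom_iff[OF A D] Cend_hom_iff[OF D A] Cend_hom_form_def semilin_def
  by (intro conjI allI ballI lA(1) rA(1) lB(1) rB(1) ev_in D_eqI A_eqI A.carr_closed D.carr_closed;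
      simp add: lA rA lB rB ev_in D_add D_act prod_add_act act_D_apply poly_pcompose algebra_simps)+

sublocale pair: algebra_pair A D lA rA lB rB
  by unfold_locales (intro alg_A alg_D Cend_hom_ops)+

end

subsection \<open>Double constructions\<close>

context dual_algebras
begin

lemma pairing_eval: "poly (pairing_form (a, f) (b, g)) l = poly (f b) l + poly (g a) (- l)"
  by (simp add: pairing_form_def poly_pcompose)

lemma bicrossed_eval:
  assumes "a \<in> carr A" "f \<in> carr D" "b \<in> carr A" "g \<in> carr D"
    and "pair.bicrossed l (a, f) (b, g) = (c, k)"
  shows "c \<in> carr A" "k \<in> carr D"
    and "h \<in> carr D \<Longrightarrow> poly (h c) m = poly (h (ev A l (lprod A a b))) m +
      poly (ev D m (lprod D h f) b) (l + m) + poly (ev D (- l - m) (lprod D g h) a) (- l)"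
    and "c' \<in> carr A \<Longrightarrow> poly (k c') m = poly (ev D l (lprod D f g) c') m +
      poly (g (ev A (- m) (lprod A c' a))) (m - l) + poly (f (ev A (m - l) (lprod A b c'))) l"
  using assms by (auto simp: pair.bicrossed_def ev_in D_add lA lB evd_rA evd_rB)

text \<open>Both sides are the sum of the same six scalars: f at l of \<open>b\<close> times
  \<open>c\<close>, g at m-l of \<open>c\<close> times \<open>a\<close>, h at -m of \<open>a\<close>
  times \<open>b\<close>, and the three terms obtained by exchanging the roles of \<open>A\<close>
  and \<open>D\<close>.\<close>

lemma bicrossed_invariant:
  assumes in': "a \<in> carr A" "f \<in> carr D" "b \<in> carr A" "g \<in> carr D" "c \<in> carr A" "h \<in> carr D"
  shows "poly (pairing_form (pair.bicrossed l (a, f) (b, g)) (c, h)) m =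
    poly (pairing_form (a, f) (pair.bicrossed (m - l) (b, g) (c, h))) l"
proof -
  obtain c1 k1 where 1: "pair.bicrossed l (a, f) (b, g) = (c1, k1)" by fastforce
  obtain c2 k2 where 2: "pair.bicrossed (m - l) (b, g) (c, h) = (c2, k2)" by fastforce
  show ?thesis
    unfolding 1 2 pairing_eval
    using bicrossed_eval(3,4)[OF in'(1-4) 1] bicrossed_eval(3,4)[OF in'(3-6) 2] in' by simp
qed

text \<open>Surjectivity of the map from \<open>A\<close> to its bidual: the representing element
  has the values of \<psi> on the dual basis as coordinates, with the variable negated to match the
  twisted action on \<open>D\<close>.\<close>

lemma bidual_representable:
  assumes add: "\<And>f g. f \<in> carr D \<Longrightarrow> g \<in> carr D \<Longrightarrow> \<psi> (f + g) = \<psi> f + \<psi> g"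
    and act: "\<And>p f. f \<in> carr D \<Longrightarrow> \<psi> (act D p f) = p * \<psi> f"
  obtains a where "a \<in> carr A" "\<And>g. g \<in> carr D \<Longrightarrow> \<psi> g = pcompose (g a) [:0, - 1:]"
proof -
  have \<psi>0: "\<psi> 0 = 0" using add[of 0 0] by simp
  have \<psi>_sum: "\<psi> (sum x I) = (\<Sum>i\<in>I. \<psi> (x i))" if "\<And>i. i \<in> I \<Longrightarrow> x i \<in> carr D" for x and I :: "'a set"
    using that by (induction I rule: infinite_finite_induct) (auto simp: \<psi>0 add D.carr_sum)
  define a where "a = (\<Sum>e\<in>S. act A (pcompose (\<psi> (dual_basis e)) [:0, - 1:]) e)"
  have inv: "pcompose (pcompose p [:0, - 1:]) [:0, - 1:] = p" for p :: "complex poly"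
    by (simp flip: pcompose_assoc) (simp add: pcompose_pCons)
  have "\<psi> g = pcompose (g a) [:0, - 1:]" if g: "g \<in> carr D" for g
  proof -
    have "\<psi> g = (\<Sum>e\<in>S. pcompose (g e) [:0, - 1:] * \<psi> (dual_basis e))"
      using g by (subst dual_expand) (auto simp: \<psi>_sum act dual_basis_in)
    then show ?thesis
      using g by (simp add: a_def D_sum D_act basis_in pcompose_sum pcompose_mult inv mult.commute)
  qed
  moreover have "a \<in> carr A"
    unfolding a_def by (intro A.carr_sum) (auto simp: basis_in)
  ultimately show thesis using that by blast
qed

text \<open>Non-degeneracy is reflexivity of \<open>A\<close>: a functional on the sum restricts to
  \<open>A\<close> as an element of \<open>D\<close>, and to \<open>D\<close> as an element of the
  bidual, which comes from \<open>A\<close> by \<open>bidual_representable\<close>.\<close>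

lemma pairing_form_props:
  fixes E :: "('a \<times> ('a \<Rightarrow> complex poly), 'k) cmodule_scheme"
  assumes E: "carr E = carr (direct_sum A D)" "act E = act (direct_sum A D)"
  shows "conf_form E pairing_form" "nondegenerate E pairing_form"
    and "u \<in> carr E \<Longrightarrow> semilin E triv_module [:l:] (\<lambda>w. poly (pairing_form u w) l)"
proof -
  have carr_E: "carr E = carr A \<times> carr D" and act_E: "act E p (a, f) = (act A p a, act D p f)" for p a f
    by (auto simp: E direct_sum_def)
  have mE: "conf_module E"
    using conf_module_direct_sum[OF A D] conf_module_cong[OF E] by simp
  have right: "semilin E triv_module [:l:] (\<lambda>w. poly (pairing_form u w) l)" if "u \<in> carr E" for u l
    using that unfolding semilin_def
    by (auto simp: carr_E act_E pairing_eval D_add D_act act_D_apply poly_pcompose algebra_simps)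
  have left: "semilin E triv_module [:- l:] (\<lambda>w. poly (pairing_form w u) l)" if "u \<in> carr E" for u l
    using that unfolding semilin_def
    by (auto simp: carr_E act_E pairing_eval D_add D_act act_D_apply poly_pcompose algebra_simps)
  show "semilin E triv_module [:l:] (\<lambda>w. poly (pairing_form u w) l)" if "u \<in> carr E"
    using that by (rule right)
  have "clinear_map E triv_module (pairing_form u)" if "u \<in> carr E" for u
    using right[OF that] clinear_map_der_iff[OF mE conf_module_triv, of "pairing_form u" "\<lambda>l. [:l:]"]
    by simp
  moreover have "clinear_map E triv_module (\<lambda>w. pairing_form w u)" if "u \<in> carr E" for u
    using left[OF that]
      clinear_map_der_iff[OF mE conf_module_triv, of "\<lambda>w. pairing_form w u" "\<lambda>l. [:- l:]"]
    by simp
  moreover have "pairing_form (der E u) v = - ([:0, 1:] * pairing_form u v)"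
    "pairing_form u (der E v) = [:0, 1:] * pairing_form u v" if "u \<in> carr E" "v \<in> carr E" for u v
    using semilin_act[OF left[OF that(2)] that(1), of "[:0, 1:]"]
      semilin_act[OF right[OF that(1)] that(2), of "[:0, 1:]"]
    by (auto simp: der_def pcompose_pCons intro!: poly_ext)
  ultimately show "conf_form E pairing_form"
    unfolding conf_form_def by blast
  let ?\<Phi> = "\<lambda>v w. if w \<in> carr E then pairing_form v w else 0"
  have \<Phi>_in: "?\<Phi> u \<in> carr (cdual E)" if "u \<in> carr E" for u
    unfolding cdual_iff[OF mE] using semilin_cong[OF right[OF that] _ mE] by auto
  have "inj_on ?\<Phi> (carr E)"
  proof (rule inj_onI)
    fix u v assume uv: "u \<in> carr E" "v \<in> carr E" "?\<Phi> u = ?\<Phi> v"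
    obtain a f b g where eq: "u = (a, f)" "v = (b, g)" by (cases u, cases v)
    have in': "a \<in> carr A" "b \<in> carr A" "f \<in> carr D" "g \<in> carr D"
      using uv eq carr_E by auto
    have *: "poly (f x) m + poly (h a) (- m) = poly (g x) m + poly (h b) (- m)"
      if "x \<in> carr A" "h \<in> carr D" for x h m
      using fun_cong[OF uv(3), of "(x, h)"] that
      by (simp add: carr_E eq flip: pairing_eval)
    \<comment> \<open>Setting h = 0 isolates the dual components; setting x = 0 in the next line
      isolates those in \<open>A\<close>, where the sign of m compensates the reversed variable in
      the pairing.\<close>
    have "f = g" using in' *[of _ 0] by (intro D_eqI) auto
    moreover have "a = b" using in' *[of 0, of _ "- m" for m] by (intro A_eqI) (auto simp: D_0)
    ultimately show "u = v" by (simp add: eq)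
  qed
  moreover have "\<phi> \<in> ?\<Phi> ` carr E" if \<phi>: "\<phi> \<in> carr (cdual E)" for \<phi>
  proof -
    have \<phi>_semi: "semilin E triv_module [:m:] (\<lambda>w. poly (\<phi> w) m)" for m
      using \<phi> by (simp add: cdual_iff[OF mE])
    have \<phi>_add: "\<phi> (u + v) = \<phi> u + \<phi> v" if "u \<in> carr E" "v \<in> carr E" for u v
      using semilin_add[OF \<phi>_semi that] by (intro poly_ext) simp
    have \<phi>_act: "\<phi> (act E p u) = p * \<phi> u" if "u \<in> carr E" for p u
      using semilin_act[OF \<phi>_semi that] by (intro poly_ext) (simp add: poly_pcompose)
    define f where "f x = (if x \<in> carr A then \<phi> (x, 0) else 0)" for x
    have f: "f \<in> carr D"
      using \<phi>_add[of "(x, 0)" "(y, 0)" for x y] \<phi>_act[of "(x, 0)" for x]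
      by (intro DI) (auto simp: f_def carr_E act_E)
    obtain a where a: "a \<in> carr A" "\<And>g. g \<in> carr D \<Longrightarrow> \<phi> (0, g) = pcompose (g a) [:0, - 1:]"
      using \<phi>_add[of "(0, g)" "(0, h)" for g h] \<phi>_act[of "(0, g)" for g]
      by - (rule bidual_representable[of "\<lambda>g. \<phi> (0, g)"], auto simp: carr_E act_E)
    have "\<phi> = ?\<Phi> (a, f)"
    proof
      fix w
      show "\<phi> w = ?\<Phi> (a, f) w"
      proof (cases "w \<in> carr E")
        case True
        obtain b g where w: "w = (b, g)" by (cases w)
        with True have bg: "b \<in> carr A" "g \<in> carr D" by (auto simp: carr_E)
        have "\<phi> w = \<phi> (b, 0) + \<phi> (0, g)"
          using \<phi>_add[of "(b, 0)" "(0, g)"] bg by (simp add: w carr_E)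
        then show ?thesis
          using a bg True by (simp add: w f_def pairing_form_def)
      qed (use \<phi> in \<open>simp add: cdual_iff[OF mE] del: split_paired_All\<close>)
    qed
    then show ?thesis using a f carr_E by blast
  qed
  ultimately have "bij_betw ?\<Phi> (carr E) (carr (cdual E))"
    using \<Phi>_in by (auto simp: bij_betw_def)
  moreover have "?\<Phi> (u + v) = ?\<Phi> u + ?\<Phi> v" if "u \<in> carr E" "v \<in> carr E" for u v
    using semilin_add[OF left that] by (auto intro!: ext poly_ext)
  moreover have "?\<Phi> (act E p u) = act (cdual E) p (?\<Phi> u)" if "u \<in> carr E" for p u
    using semilin_act[OF left that] by (auto simp: cdual_def poly_pcompose intro!: ext poly_ext)
  ultimately show "nondegenerate E pairing_form"
    unfolding nondegenerate_def cmodule_iso_def by blast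
qed

section \<open>From double constructions to matched pairs\<close>

lemma double_construction_imp_matched_pair:
  fixes E :: "('a \<times> ('a \<Rightarrow> complex poly), 'k) calgebra_scheme"
  assumes dc: "double_construction A D E"
  shows "matched_pair A D lA rA lB rB"
proof -
  have E: "carr E = carr (direct_sum A D)" "act E = act (direct_sum A D)"
    using dc underlying_eqD[of E] by (auto simp: double_construction_def)
  have carr_E: "carr E = carr A \<times> carr D" by (simp add: E direct_sum_def)
  have fr: "frobenius E pairing_form" using dc by (simp add: double_construction_def)
  then have alg_E: "conf_algebra E" by (simp add: frobenius_def)
  interpret E: conf_mod E using alg_E by unfold_locales (simp add: conf_algebra_def)
  note form_E = Cend_hom_formD[OF conf_algebra_form[OF alg_E]]
  define \<mu> where "\<mu> l u v = ev E l (lprod E u v)" for l u v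
  have \<mu>_in: "\<mu> l u v \<in> carr E" if "u \<in> carr E" "v \<in> carr E" for l u v
    using that unfolding \<mu>_def by (intro E.ev_closed form_E)
  have inv: "poly (pairing_form (\<mu> l u v) w) m = poly (pairing_form u (\<mu> (m - l) v w)) l"
    if "u \<in> carr E" "v \<in> carr E" "w \<in> carr E" for l m u v w
  proof -
    have "poly (pairing_form u (psubst E [:m, - 1:] (lprod E v w))) l =
        poly (pairing_form u (ev E (poly [:m, - 1:] l) (lprod E v w))) l"
      using that
      by (intro psubst_point[OF E.conf_module conf_module_triv pairing_form_props(3)[OF E]] form_E)
    then show ?thesis using fr that by (simp add: frobenius_def \<mu>_def)
  qed
  have sym: "poly (pairing_form u v) l = poly (pairing_form v u) (- l)" for u v :: "'a \<times> ('a \<Rightarrow> complex poly)" and l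
    by (cases u, cases v) (simp add: pairing_eval)
  \<comment> \<open>Invariance for the rotated triple w, u, v, returned to the original order by the
    symmetry \<open>sym\<close> of the pairing. With \<open>inv\<close> and \<open>inv'\<close> a
    mixed product can be rotated into either neighbouring product.\<close>
  have inv': "poly (pairing_form (\<mu> l u v) w) m = poly (pairing_form (\<mu> (- m) w u) v) (l - m)"
    if "u \<in> carr E" "v \<in> carr E" "w \<in> carr E" for l m u v w
    using inv[OF that(3,1,2), of "- m" "l - m"] sym[of "\<mu> l u v" w m] by simp
  have AA: "\<mu> l (a, 0) (b, 0) = (ev A l (lprod A a b), 0)" if "a \<in> carr A" "b \<in> carr A" for l a b
  proof -
    have "semilin A E [:0, 1:] (\<lambda>c. (c, 0))" by (auto simp: semilin_def E direct_sum_def)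
    then show ?thesis
      unfolding \<mu>_def using that dc ev_semilin[OF A E.conf_module _ form_A(1)]
      by (simp add: double_construction_def)
  qed
  have DD: "\<mu> l (0, f) (0, g) = (0, ev D l (lprod D f g))" if "f \<in> carr D" "g \<in> carr D" for l f g
  proof -
    have "semilin D E [:0, 1:] (\<lambda>h. (0, h))" by (auto simp: semilin_def E direct_sum_def)
    then show ?thesis
      unfolding \<mu>_def using that dc ev_semilin[OF D E.conf_module _ form_D(1)]
      by (simp add: double_construction_def)
  qed
  \<comment> \<open>Each component is found by pairing with the summand that makes a pure product
    appear: against \<open>A\<close>, \<open>inv'\<close> leads to a product in \<open>A\<close> and
    yields the dual component; against \<open>D\<close>, \<open>inv\<close> leads to a product in
    \<open>D\<close> and yields the component in \<open>A\<close>.\<close>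
  have AD: "\<mu> l (a, 0) (0, g) = (evd A l (rB g a), ev D l (lA a g))"
    if a: "a \<in> carr A" and g: "g \<in> carr D" for l a g
  proof -
    obtain c k where ck: "\<mu> l (a, 0) (0, g) = (c, k)" by fastforce
    have in': "c \<in> carr A" "k \<in> carr D"
      using \<mu>_in[of "(a, 0)" "(0, g)" l] a g by (auto simp: carr_E ck)
    have "poly (k b) m = poly (ev D l (lA a g) b) m" if b: "b \<in> carr A" for b m
      using inv'[of "(a, 0)" "(0, g)" "(b, 0)" l m] a g b
      by (simp add: carr_E ck AA pairing_eval lA)
    then have "k = ev D l (lA a g)" using in' a g by (intro D_eqI ev_in)
    moreover have "poly (h c) m = poly (h (evd A l (rB g a))) m" if h: "h \<in> carr D" for h m
    proof -
      have "- m - l = - l - m" by simp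
      from inv[of "(a, 0)" "(0, g)" "(0, h)" l "- m", unfolded this] show ?thesis
        using a g h in'
        by (simp add: carr_E ck DD pairing_eval evd_rB D_0)
    qed
    then have "c = evd A l (rB g a)" using in' a g by (intro A_eqI ev_in)
    ultimately show ?thesis by (simp add: ck)
  qed
  \<comment> \<open>As before with \<open>inv\<close> and \<open>inv'\<close> exchanged, since now
    the right factor lies in \<open>A\<close> and the left one in \<open>D\<close>.\<close>
  have DA: "\<mu> l (0, f) (b, 0) = (ev A l (lB f b), evd D l (rA b f))"
    if f: "f \<in> carr D" and b: "b \<in> carr A" for l f b
  proof -
    obtain c k where ck: "\<mu> l (0, f) (b, 0) = (c, k)" by fastforce
    have in': "c \<in> carr A" "k \<in> carr D"
      using \<mu>_in[of "(0, f)" "(b, 0)" l] f b by (auto simp: carr_E ck)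
    have "poly (k c') m = poly (evd D l (rA b f) c') m" if c': "c' \<in> carr A" for c' m
      using inv[of "(0, f)" "(b, 0)" "(c', 0)" l m] f b c'
      by (simp add: carr_E ck AA pairing_eval evd_rA)
    then have "k = evd D l (rA b f)" using in' f b by (intro D_eqI ev_in)
    moreover have "poly (h c) m = poly (h (ev A l (lB f b))) m" if h: "h \<in> carr D" for h m
      using inv'[of "(0, f)" "(b, 0)" "(0, h)" l "- m"] f b h in'
      by (simp add: carr_E ck DD pairing_eval lB D_0)
    then have "c = ev A l (lB f b)" using in' f b by (intro A_eqI ev_in)
    ultimately show ?thesis by (simp add: ck)
  qed
  have prod: "ev E l (lprod E u v) = pair.bicrossed l u v" if uv: "u \<in> carr E" "v \<in> carr E" for l u v
  proof -
    obtain a f b g where eq: "u = (a, f)" "v = (b, g)" by (cases u, cases v)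
    have in': "a \<in> carr A" "b \<in> carr A" "f \<in> carr D" "g \<in> carr D"
      using uv eq carr_E by auto
    have add1: "\<mu> l (x + y) w = \<mu> l x w + \<mu> l y w" and add2: "\<mu> l w (x + y) = \<mu> l w x + \<mu> l w y"
      if "x \<in> carr E" "y \<in> carr E" "w \<in> carr E" for x y w
      using that semilin_add[OF form_E(3)] semilin_add[OF form_E(2)] by (auto simp: \<mu>_def)
    have "\<mu> l u v = \<mu> l ((a, 0) + (0, f)) ((b, 0) + (0, g))" by (simp add: eq)
    also have "\<dots> = (\<mu> l (a, 0) (b, 0) + \<mu> l (0, f) (b, 0)) + (\<mu> l (a, 0) (0, g) + \<mu> l (0, f) (0, g))"
    proof -
      have "(a, 0) \<in> carr E" "(0, f) \<in> carr E" "(b, 0) \<in> carr E" "(0, g) \<in> carr E"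
        using in' by (auto simp: carr_E)
      then show ?thesis by (simp only: add1 add2 E.carr_closed)
    qed
    also have "\<dots> = pair.bicrossed l u v"
      using in' by (simp add: AA DA AD DD pair.bicrossed_def eq ac_simps)
    finally show ?thesis by (simp add: \<mu>_def)
  qed
  show ?thesis
    using pair.conf_algebra_iff_matched_pair[OF E form_E(1) prod] alg_E by blast
qed

section \<open>From matched pairs to double constructions\<close>

lemma matched_pair_imp_double_construction:
  assumes mp: "matched_pair A D lA rA lB rB"
  obtains E :: "('a \<times> ('a \<Rightarrow> complex poly)) calgebra" where "double_construction A D E"
proof -
  let ?M = "direct_sum A D"
  define E :: "('a \<times> ('a \<Rightarrow> complex poly)) calgebra" where
    \<comment> \<open>The product is known through its values only; \<open>SOME\<close> selects a
      polynomial with these values, which exists on the carrier by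
      \<open>bicrossed_polyf\<close>.\<close>
    "E = \<lparr>carr = carr ?M, act = act ?M, lprod = (\<lambda>u v. SOME P. (\<forall>k. coeff P k \<in> carr ?M) \<and>
       (\<forall>l. ev ?M l P = pair.bicrossed l u v))\<rparr>"
  have E: "carr E = carr ?M" "act E = act ?M" by (simp_all add: E_def)
  have carr_E: "carr E = carr A \<times> carr D" by (simp add: E direct_sum_def)
  interpret E: conf_mod E
    using conf_module_direct_sum[OF A D] conf_module_cong[OF E] by unfold_locales simp
  have *: "(\<forall>k. coeff (lprod E u v) k \<in> carr E) \<and> (\<forall>l. ev E l (lprod E u v) = pair.bicrossed l u v)"
    if uv: "u \<in> carr E" "v \<in> carr E" for u v
    using someI_ex[OF pair.bicrossed_polyf[of u v, unfolded polyf_def]] uv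
    by (simp add: E ev_cong[OF E(2)]) (simp add: E_def)
  have alg_E: "conf_algebra E"
    using pair.conf_algebra_iff_matched_pair[OF E] * mp by blast
  have "poly (pairing_form (ev E l (lprod E u v)) w) m =
      poly (pairing_form u (psubst E [:m, - 1:] (lprod E v w))) l"
    if uvw: "u \<in> carr E" "v \<in> carr E" "w \<in> carr E" for l m u v w
  proof -
    have "poly (pairing_form u (psubst E [:m, - 1:] (lprod E v w))) l =
        poly (pairing_form u (ev E (poly [:m, - 1:] l) (lprod E v w))) l"
      using uvw *
      by (intro psubst_point[OF E.conf_module conf_module_triv pairing_form_props(3)[OF E]]) auto
    then show ?thesis
      using uvw * bicrossed_invariant by (auto simp: carr_E)
  qed
  then have fr: "frobenius E pairing_form"
    using alg_E pairing_form_props[OF E] by (simp add: frobenius_def)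
  have AA: "lprod E (a, 0) (b, 0) = map_poly (\<lambda>c. (c, 0)) (lprod A a b)"
    if "a \<in> carr A" "b \<in> carr A" for a b
  proof (rule E.ev_inject)
    have i: "semilin A E [:0, 1:] (\<lambda>c. (c, 0))" by (auto simp: semilin_def E direct_sum_def)
    show "ev E l (lprod E (a, 0) (b, 0)) = ev E l (map_poly (\<lambda>c. (c, 0)) (lprod A a b))" for l
      using that * ev_semilin[OF A E.conf_module i form_A(1)] pair.ops_biadditive[THEN biadditive_D(4)]
        pair.ops_biadditive[THEN biadditive_D(5)] form_A
      by (simp add: carr_E pair.bicrossed_def)
  qed
  have DD: "lprod E (0, f) (0, g) = map_poly (\<lambda>h. (0, h)) (lprod D f g)"
    if "f \<in> carr D" "g \<in> carr D" for f g
  proof (rule E.ev_inject)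
    have i: "semilin D E [:0, 1:] (\<lambda>h. (0, h))" by (auto simp: semilin_def E direct_sum_def)
    show "ev E l (lprod E (0, f) (0, g)) = ev E l (map_poly (\<lambda>h. (0, h)) (lprod D f g))" for l
      using that * ev_semilin[OF D E.conf_module i form_D(1)] pair.ops_biadditive[THEN biadditive_D(4)]
        pair.ops_biadditive[THEN biadditive_D(5)] form_D
      by (simp add: carr_E pair.bicrossed_def)
  qed
  have "conf_subalgebra ((\<lambda>b. (b, 0)) ` carr A) E"
    unfolding conf_subalgebra_def E.subspace_def
    using AA form_A by (auto simp: carr_E coeff_map_poly zero_prod_def) (auto simp: E direct_sum_def)
  moreover have "conf_subalgebra ((\<lambda>f. (0, f)) ` carr D) E"
    unfolding conf_subalgebra_def E.subspace_def
    using DD form_D by (auto simp: carr_E coeff_map_poly zero_prod_def) (auto simp: E direct_sum_def)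
  moreover have "underlying E = ?M"
    by (simp add: E_def direct_sum_def cmodule.truncate_def)
  ultimately have "double_construction A D E"
    unfolding double_construction_def using fr AA DD by blast
  then show thesis by (rule that)
qed

end

text \<open>Finite generation and freeness come with unrelated sets, and the basis may a priori be
  infinite. Each of the finitely many generators involves finitely many basis elements, so a finite
  part of the basis already spans, and it inherits independence.\<close>

lemma finite_free_basis:
  assumes A: "conf_module A" and fin: "finite_module A" and free: "free_module A"
  obtains S where "finite S" "S \<subseteq> carr A" "\<not> module.dependent (act A) S" "module.span (act A) S = carr A"
proof -
  interpret A: conf_mod A by unfold_locales fact
  obtain S where S: "S \<subseteq> carr A" "A.independent S" "A.span S = carr A"
    using free unfolding free_module_def by blast
  obtain T where T: "finite T" "T \<subseteq> carr A" "A.span T = carr A"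
    using fin unfolding finite_module_def by blast
  have "\<exists>U. finite U \<and> U \<subseteq> S \<and> t \<in> A.span U" if "t \<in> T" for t
  proof -
    have "t \<in> A.span S" using that T S by auto
    then obtain U r where U: "finite U" "U \<subseteq> S" and t: "t = (\<Sum>a\<in>U. act A (r a) a)"
      unfolding A.span_explicit by blast
    have "t \<in> A.span U" unfolding t by (intro A.span_sum A.span_scale A.span_base)
    with U show ?thesis by blast
  qed
  then obtain U where U: "\<And>t. t \<in> T \<Longrightarrow> finite (U t) \<and> U t \<subseteq> S \<and> t \<in> A.span (U t)"
    by metis
  define S' where "S' = (\<Union>t\<in>T. U t)"
  have "finite S'" "S' \<subseteq> S" using T(1) U by (auto simp: S'_def)
  have "t \<in> A.span S'" if "t \<in> T" for t
    using U[OF that] A.span_mono[of "U t" S'] that by (auto simp: S'_def)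
  then have "A.span T \<subseteq> A.span S'"
    by (intro A.span_minimal A.subspace_span) blast
  then have "A.span S' = carr A"
    using A.span_mono[OF \<open>S' \<subseteq> S\<close>] T(3) S(3) by simp
  moreover have "A.independent S'"
    using S(2) \<open>S' \<subseteq> S\<close> by (rule A.independent_mono)
  ultimately show thesis
    using \<open>finite S'\<close> \<open>S' \<subseteq> S\<close> S(1) by (intro that[of S']) blast+
qed

theorem theorem3p6:
  fixes A :: "'a::ab_group_add calgebra"
    and D :: "('a \<Rightarrow> complex poly) calgebra"
  assumes "conf_algebra A" and "finite_module A" and "free_module A"
    and "conf_algebra D" and "underlying D = cdual A"
  shows "(\<exists>E :: ('a \<times> ('a \<Rightarrow> complex poly)) calgebra. double_construction A D E) \<longleftrightarrow>
    matched_pair A D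
      (dual_op A (Rmul A)) (dual_op A (Lmul A))
      (codual_op A D (Rmul D)) (codual_op A D (Lmul D))"
proof -
  have "conf_module A" using assms(1) by (simp add: conf_algebra_def)
  then obtain S where "finite S" "S \<subseteq> carr A" "\<not> module.dependent (act A) S"
    "module.span (act A) S = carr A"
    using finite_free_basis assms(2,3) by blast
  then interpret dual_algebras A D S
    using assms by unfold_locales
  show ?thesis
    using double_construction_imp_matched_pair matched_pair_imp_double_construction by metis
qed

end
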